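(* Let $k>0$, $\gamma>0$ and let $p\in(1,2)$ be rational. Consider a rigid body with configuration $g\in SE(3)$ and velocity $\xi\in\mathbb R^6$ satisfying $\dot g=g\xi^\vee$ and $\mathbb I\dot\xi=\mathrm{ad}^*_\xi\,\mathbb I\xi+\varphi$, where $\varphi$ is the (known) resultant of the moments and forces acting on the body. Let $(\hat g,\hat\xi)$ be estimates of $(g,\xi)$ and put $h=\hat g^{-1}g$, $\tilde\eta^\vee=\mathrm{logm}(h)$, $\breve\xi=\mathrm{Ad}_{h^{-1}}\hat\xi$, $\tilde\xi=\xi-\breve\xi$ and $$u=\tilde\xi+k\frac{\tilde\eta}{(\tilde\eta^T\tilde\eta)^{1-\frac1p}}.$$ Then the observer dynamics $$\dot{\hat g}=\hat g\,\hat\xi^\vee\qquad(\text{equivalently } \dot{\tilde\eta}=G(\tilde\eta)\tilde\xi\ \text{ and }\ \hat g=g\,\mathrm{expm}(-\tilde\eta^\vee)),$$ $$\mathbb I\dot{\breve\xi}=\mathrm{ad}^*_{\left(\breve\xi-k(\tilde\eta^T\tilde\eta)^{\frac1p-1}\tilde\eta\right)}\mathbb I\xi+\varphi+k\,\mathbb I\,H(\tilde\eta)G(\tilde\eta)\tilde\xi+\gamma G^T(\tilde\eta)\tilde\eta+k\frac{\mathbb Iu}{(u^T\mathbb Iu)^{1-\frac1p}},$$ where $$H(\tilde\eta)=\frac1{(\tilde\eta^T\tilde\eta)^{1-\frac1p}}\Big\{I-2\Big(1-\frac1p\Big)\frac{\tilde\eta\tilde\eta^T}{\tilde\eta^T\tilde\eta}\Big\},$$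 ensures that the estimate errors converge to the origin in finite time: along solutions for which the exponential coordinates $\tilde\eta$ are defined, there is a finite $t_f$ such that $(\tilde\xi,\tilde\eta)=(0,0)\in\mathbb R^6\times\mathbb R^6$ for all $t\ge t_f$.
   Context: For $a\in\mathbb R^3$, $a^\times$ is the skew-symmetric matrix with $a^\times c=a\times c$. For $\zeta=[w^T, u^T]^T\in\mathbb R^6$: $\zeta^\vee=\begin{bmatrix} w^\times & u \\ 0 & 0 \end{bmatrix}$, $\mathrm{ad}_\zeta=\begin{bmatrix} w^\times & 0 \\ {u}^\times & w^\times \end{bmatrix}$, $\mathrm{ad}^*_\zeta=(\mathrm{ad}_\zeta)^T$. For $g=\begin{bmatrix} R & b \\ 0 & 1 \end{bmatrix}\in SE(3)$, $\mathrm{Ad}_g=\begin{bmatrix} R & 0 \\ {b}^\times R & R \end{bmatrix}$. $\mathbb I=\begin{bmatrix} J & 0 \\ 0 & mI \end{bmatrix}$, with $m>0$ the mass and $J$ the symmetric positive definite inertia matrix. Expressions of the form $x/(x^Tx)^{1-1/p}$ (and $\mathbb Iu/(u^T\mathbb Iu)^{1-1/p}$) are extended continuously by $0$ at $x=0$ (resp. $u=0$), which is possible since $p<2$. $\mathrm{logm}$, $\mathrm{expm}$ are the logarithm and exponential on $SE(3)$; the exponential coordinate vector is defined for poses whose rotation part has principal angle less than $\pi$. For $\eta=[\Theta^T, \beta^T]^T$ with $\theta=\|\Theta\|$, $G(\eta)=\begin{bmatrix} A(\Theta) & 0 \\ {T}(\Theta,\beta) & A(\Theta) \end{bmatrix}$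 is the matrix with $\dot{\tilde\eta}=G(\tilde\eta)\tilde\xi$, where (removable singularity at $\theta=0$ filled in by continuity) $$A(\Theta)=I+\tfrac12\Theta^\times+\Big(\tfrac1{\theta^2}-\tfrac{1+\cos\theta}{2\theta\sin\theta}\Big)(\Theta^\times)^2,\qquad S(\Theta)=I+\tfrac{1-\cos\theta}{\theta^2}\Theta^\times+\tfrac{\theta-\sin\theta}{\theta^3}(\Theta^\times)^2,$$ $$T(\Theta,\beta)=\tfrac12(S(\Theta)\beta)^\times A(\Theta)+\Big(\tfrac1{\theta^2}-\tfrac{1+\cos\theta}{2\theta\sin\theta}\Big)\big[\Theta\beta^T+(\Theta^T\beta)A(\Theta)\big]-\tfrac{(1+\cos\theta)(\theta-\sin\theta)}{2\theta\sin^2\theta}S(\Theta)\beta\Theta^T+\Big(\tfrac{(1+\cos\theta)(\theta+\sin\theta)}{2\theta^3\sin^2\theta}-\tfrac2{\theta^4}\Big)(\Theta^T\beta)\Theta\Theta^T.$$ *)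

theory Defs
  imports "HOL-Analysis.Analysis"
begin

text \<open>
  Vectors of dimension 6 are indexed by the sum type \<open>3 + 3\<close> (rotational component first) and
  homogeneous 4 by 4 matrices by \<open>3 + 1\<close>, so that the block structure is literal.
\<close>

definition blockmat ::
    "real^'b^'a \<Rightarrow> real^'d^'a \<Rightarrow> real^'b^'c \<Rightarrow> real^'d^'c \<Rightarrow> real^('b + 'd)^('a + 'c)" where
  "blockmat A B C D = (\<chi> i j. case i of
      Inl a \<Rightarrow> (case j of Inl b \<Rightarrow> A $ a $ b | Inr d \<Rightarrow> B $ a $ d)
    | Inr c \<Rightarrow> (case j of Inl b \<Rightarrow> C $ c $ b | Inr d \<Rightarrow> D $ c $ d))"

definition rotv :: "real^(3 + 3) \<Rightarrow> real^3" where
  "rotv \<zeta> = (\<chi> i. \<zeta> $ Inl i)"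

definition transv :: "real^(3 + 3) \<Rightarrow> real^3" where
  "transv \<zeta> = (\<chi> i. \<zeta> $ Inr i)"

definition rotm :: "real^(3 + 1)^(3 + 1) \<Rightarrow> real^3^3" where
  "rotm g = (\<chi> i j. g $ Inl i $ Inl j)"

definition posv :: "real^(3 + 1)^(3 + 1) \<Rightarrow> real^3" where
  "posv g = (\<chi> i. g $ Inl i $ Inr 1)"

definition skew :: "real^3 \<Rightarrow> real^3^3" where
  "skew a = matrix (cross3 a)"

definition outer :: "real^'n \<Rightarrow> real^'m \<Rightarrow> real^'m^'n" where
  "outer x y = (\<chi> i j. x $ i * y $ j)"

definition vee :: "real^(3 + 3) \<Rightarrow> real^(3 + 1)^(3 + 1)" where
  "vee \<zeta> = blockmat (skew (rotv \<zeta>)) (columnvector (transv \<zeta>)) 0 0"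

definition ad :: "real^(3 + 3) \<Rightarrow> real^(3 + 3)^(3 + 3)" where
  "ad \<zeta> = blockmat (skew (rotv \<zeta>)) 0 (skew (transv \<zeta>)) (skew (rotv \<zeta>))"

definition ad_star :: "real^(3 + 3) \<Rightarrow> real^(3 + 3)^(3 + 3)" where
  "ad_star \<zeta> = transpose (ad \<zeta>)"

definition Ad :: "real^(3 + 1)^(3 + 1) \<Rightarrow> real^(3 + 3)^(3 + 3)" where
  "Ad g = blockmat (rotm g) 0 (skew (posv g) ** rotm g) (rotm g)"

definition SE3 :: "(real^(3 + 1)^(3 + 1)) set" where
  "SE3 = {blockmat R (columnvector b) 0 (mat 1) | R b. rotation_matrix R}"

definition inertia :: "real^3^3 \<Rightarrow> real \<Rightarrow> real^(3 + 3)^(3 + 3)" where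
  "inertia J m = blockmat J 0 0 (m *\<^sub>R mat 1)"

definition expm :: "real^'n^'n \<Rightarrow> real^'n^'n" where
  "expm A = (\<Sum>n. (1 / fact n) *\<^sub>R ((\<lambda>X. A ** X) ^^ n) (mat 1))"

definition principal_angle :: "real^3^3 \<Rightarrow> real" where
  "principal_angle R = arccos ((trace R - 1) / 2)"

text \<open>
  The eigenvalues of \<open>vee \<eta>\<close> are \<open>0\<close> and \<open>\<plusminus> \<i> norm (rotv \<eta>)\<close>, so the norm bound selects the
  principal logarithm.  It is meaningful only for poses in \<open>SE3\<close> with principal angle less
  than \<open>pi\<close>.
\<close>

definition logm :: "real^(3 + 1)^(3 + 1) \<Rightarrow> real^(3 + 1)^(3 + 1)" where
  "logm h = (THE X. \<exists>\<eta>. X = vee \<eta> \<and> norm (rotv \<eta>) < pi \<and> expm X = h)"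

text \<open>
  In the following matrices, every coefficient with a removable singularity at \<open>norm \<Theta> = 0\<close> is
  multiplied by a factor that vanishes at \<open>\<Theta> = 0\<close>.  Hence the convention \<open>x / 0 = 0\<close> produces the
  values at \<open>\<Theta> = 0\<close> that continuity prescribes, namely \<open>A = S = mat 1\<close> and
  \<open>T = (1/2) *\<^sub>R skew \<beta>\<close>.
\<close>

definition coefA :: "real \<Rightarrow> real" where
  "coefA \<theta> = 1 / \<theta>^2 - (1 + cos \<theta>) / (2 * \<theta> * sin \<theta>)"

definition Amat :: "real^3 \<Rightarrow> real^3^3" where
  "Amat \<Theta> = mat 1 + (1/2) *\<^sub>R skew \<Theta> + coefA (norm \<Theta>) *\<^sub>R (skew \<Theta> ** skew \<Theta>)"

definition Smat :: "real^3 \<Rightarrow> real^3^3" where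
  "Smat \<Theta> = (let \<theta> = norm \<Theta> in
     mat 1 + ((1 - cos \<theta>) / \<theta>^2) *\<^sub>R skew \<Theta>
           + ((\<theta> - sin \<theta>) / \<theta>^3) *\<^sub>R (skew \<Theta> ** skew \<Theta>))"

definition Tmat :: "real^3 \<Rightarrow> real^3 \<Rightarrow> real^3^3" where
  "Tmat \<Theta> \<beta> = (let \<theta> = norm \<Theta> in
     (1/2) *\<^sub>R (skew (Smat \<Theta> *v \<beta>) ** Amat \<Theta>)
     + coefA \<theta> *\<^sub>R (outer \<Theta> \<beta> + (\<Theta> \<bullet> \<beta>) *\<^sub>R Amat \<Theta>)
     - ((1 + cos \<theta>) * (\<theta> - sin \<theta>) / (2 * \<theta> * (sin \<theta>)^2)) *\<^sub>R outer (Smat \<Theta> *v \<beta>) \<Theta>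
     + (((1 + cos \<theta>) * (\<theta> + sin \<theta>) / (2 * \<theta>^3 * (sin \<theta>)^2) - 2 / \<theta>^4) * (\<Theta> \<bullet> \<beta>)) *\<^sub>R outer \<Theta> \<Theta>)"

definition Gmat :: "real^(3 + 3) \<Rightarrow> real^(3 + 3)^(3 + 3)" where
  "Gmat \<eta> = blockmat (Amat (rotv \<eta>)) 0 (Tmat (rotv \<eta>) (transv \<eta>)) (Amat (rotv \<eta>))"

text \<open>\<open>Hmat p \<eta>\<close> has a genuine singularity at \<open>\<eta> = 0\<close>; it is meaningful only for \<open>\<eta> \<noteq> 0\<close>.\<close>

definition Hmat :: "real \<Rightarrow> real^(3 + 3) \<Rightarrow> real^(3 + 3)^(3 + 3)" where
  "Hmat p \<eta> = (1 / (\<eta> \<bullet> \<eta>) powr (1 - 1/p)) *\<^sub>R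
     (mat 1 - (2 * (1 - 1/p)) *\<^sub>R ((1 / (\<eta> \<bullet> \<eta>)) *\<^sub>R outer \<eta> \<eta>))"

text \<open>
  Right-hand side of the velocity observer, for estimate errors \<open>\<eta>\<close> and \<open>\<xi>e\<close>, body velocity
  \<open>\<xi>\<close>, transported velocity estimate \<open>\<xi>b\<close>, and \<open>M\<close> the inertia matrix.  The terms of the form
  \<open>x / (x \<bullet> x) powr (1 - 1/p)\<close>, and likewise \<open>(\<eta> \<bullet> \<eta>) powr (1/p - 1) *\<^sub>R \<eta>\<close>, take their
  continuous extension \<open>0\<close> at the origin by \<open>0 powr a = 0\<close> and \<open>x / 0 = 0\<close>.
\<close>

definition observer_rhs ::
    "real^(3 + 3)^(3 + 3) \<Rightarrow> real \<Rightarrow> real \<Rightarrow> real \<Rightarrow> real^(3 + 3) \<Rightarrow> real^(3 + 3) \<Rightarrow>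
     real^(3 + 3) \<Rightarrow> real^(3 + 3) \<Rightarrow> real^(3 + 3) \<Rightarrow> real^(3 + 3) \<Rightarrow> real^(3 + 3)" where
  "observer_rhs M k \<gamma> p \<phi> \<xi> \<xi>b \<xi>e \<eta> u =
     ad_star (\<xi>b - (k * (\<eta> \<bullet> \<eta>) powr (1/p - 1)) *\<^sub>R \<eta>) *v (M *v \<xi>)
     + \<phi>
     + k *\<^sub>R (M *v (Hmat p \<eta> *v (Gmat \<eta> *v \<xi>e)))
     + \<gamma> *\<^sub>R (transpose (Gmat \<eta>) *v \<eta>)
     + k *\<^sub>R ((1 / (u \<bullet> (M *v u)) powr (1 - 1/p)) *\<^sub>R (M *v u))"

text \<open>
  \<open>H(\<eta>) G(\<eta>) \<xi>e\<close> is unbounded as \<open>\<eta>\<close> approaches \<open>0\<close> unless \<open>\<xi>e\<close> does too, so a trajectory that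
  crosses \<open>\<eta> = 0\<close> with \<open>\<xi>e \<noteq> 0\<close> has no derivative of \<open>\<xi>b\<close> there.  A solution is therefore a
  continuous \<open>\<xi>b\<close> that satisfies the equation at all times at which the right-hand side is defined,
  i.e. \<open>\<eta> t \<noteq> 0\<close>.  Any solution that is differentiable throughout is one in this sense.
\<close>

definition velocity_observer ::
    "real^(3 + 3)^(3 + 3) \<Rightarrow> real \<Rightarrow> real \<Rightarrow> real \<Rightarrow> (real \<Rightarrow> real^(3 + 3)) \<Rightarrow> (real \<Rightarrow> real^(3 + 3)) \<Rightarrow>
     (real \<Rightarrow> real^(3 + 3)) \<Rightarrow> (real \<Rightarrow> real^(3 + 3)) \<Rightarrow> (real \<Rightarrow> real^(3 + 3)) \<Rightarrow>
     (real \<Rightarrow> real^(3 + 3)) \<Rightarrow> bool" where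
  "velocity_observer M k \<gamma> p \<phi> \<xi> \<xi>b \<xi>e \<eta> u \<longleftrightarrow>
     continuous_on {0..} \<xi>b \<and>
     (\<forall>t\<ge>0. \<eta> t \<noteq> 0 \<longrightarrow>
        (\<exists>\<xi>b'. (\<xi>b has_vector_derivative \<xi>b') (at t within {0..}) \<and>
           M *v \<xi>b' = observer_rhs M k \<gamma> p (\<phi> t) (\<xi> t) (\<xi>b t) (\<xi>e t) (\<eta> t) (u t)))"

end

theory Submission
  imports Defs "HOL-Real_Asymp.Real_Asymp"
begin

unbundle cross3_syntax

text \<open>
  In the exponential coordinates \<open>\<eta>\<close> the relative pose \<open>h\<close> is \<open>pose_exp \<eta>\<close>, given by the Rodrigues
  formula, and the matrix \<open>G\<close> inverts the right-trivialised differential of \<open>pose_exp\<close>: the derivative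
  in direction \<open>G \<zeta>\<close> is \<open>pose_exp \<eta>\<close> times \<open>vee \<zeta>\<close>.  As the logarithm is continuous,
  \<open>h' = h (vee \<xi>e)\<close> and \<open>\<eta>' = G \<xi>e\<close> are therefore equivalent, and the former is equivalent to the
  kinematics of the estimated pose.

  The observer is designed such that \<open>M u' = ad\<^sup>*\<^sub>u M \<xi> - \<gamma> G\<^sup>T \<eta> - k M u / (u \<bullet> M u)\<^bsup>1-1/p\<^esup>\<close>.  As
  \<open>G \<eta> = \<eta>\<close>, the function \<open>V = (u \<bullet> M u + \<gamma> \<eta> \<bullet> \<eta>) / 2\<close> satisfies
  \<open>V' = - k (u \<bullet> M u)\<^bsup>1/p\<^esup> - k \<gamma> (\<eta> \<bullet> \<eta>)\<^bsup>1/p\<^esup> \<le> - c V\<^bsup>1/p\<^esup>\<close> as long as \<open>\<eta> \<noteq> 0\<close>, hence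
  \<open>V\<^bsup>1-1/p\<^esup>\<close> decreases at least at a constant rate.  The equation for \<open>u\<close> is unavailable where \<open>\<eta> = 0\<close>,
  but while \<open>V > 0\<close> these times are isolated, so that the decrease survives by continuity.
\<close>

subsection \<open>Block matrices and twists\<close>

text \<open>The exponent serves two purposes. As 1/p > 1/2, the feedback
  \<open>\<eta> / (\<eta> \<bullet> \<eta>) powr (1 - 1/p)\<close> extends continuously by 0, so u
  and V are continuous even at times where the observer equation is silent. As 1/p < 1, the
  comparison equation \<open>v' = - c * v powr (1/p)\<close> reaches zero in finite time. Where V =
  0, no equation for the velocity estimate is available, so V cannot be kept at zero by uniqueness
  of solutions; the integrated decay estimate excludes that it leaves zero.

  \<open>SE3\<close> is not open in the space of matrices, and the formula for the logarithm passes
  through arccos, which is not differentiable at angle 0. The logarithm is therefore never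
  differentiated. Its continuity along a curve, together with injectivity of the differential of
  \<open>pose_exp\<close>, already makes the coordinates differentiable. The injectivity comes from
  surjectivity of G: every direction is G \<zeta>, with image
  \<open>pose_exp \<eta> ** vee \<zeta>\<close>, and this vanishes only for \<zeta> = 0.\<close>

lemma sum_UNIV_Plus:
  fixes f :: "'a::finite + 'b::finite \<Rightarrow> 'c::comm_monoid_add"
  shows "sum f UNIV = (\<Sum>a\<in>UNIV. f (Inl a)) + (\<Sum>b\<in>UNIV. f (Inr b))"
  by (subst UNIV_Plus_UNIV[symmetric], subst sum.Plus) auto

lemma all_sum_type: "(\<forall>i. P i) \<longleftrightarrow> (\<forall>a. P (Inl a)) \<and> (\<forall>b. P (Inr b))"
  by (metis sum.exhaust)

lemma blockmat_mult:
  "blockmat A B C D ** blockmat A' B' C' D' =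
   blockmat (A ** A' + B ** C') (A ** B' + B ** D') (C ** A' + D ** C') (C ** B' + D ** D')"
  by (auto simp: blockmat_def matrix_matrix_mult_def vec_eq_iff sum_UNIV_Plus all_sum_type)

lemma blockmat_add: "blockmat A B C D + blockmat A' B' C' D' = blockmat (A + A') (B + B') (C + C') (D + D')"
  by (auto simp: blockmat_def vec_eq_iff all_sum_type)

lemma blockmat_diff: "blockmat A B C D - blockmat A' B' C' D' = blockmat (A - A') (B - B') (C - C') (D - D')"
  by (auto simp: blockmat_def vec_eq_iff all_sum_type)

lemma blockmat_scaleR: "c *\<^sub>R blockmat A B C D = blockmat (c *\<^sub>R A) (c *\<^sub>R B) (c *\<^sub>R C) (c *\<^sub>R D)"
  by (auto simp: blockmat_def vec_eq_iff all_sum_type)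

lemma mat_1_blockmat: "mat 1 = blockmat (mat 1) 0 0 (mat 1)"
  by (auto simp: blockmat_def mat_def vec_eq_iff all_sum_type)

lemma blockmat_eq_iff:
  "blockmat A B C D = blockmat A' B' C' D' \<longleftrightarrow> A = A' \<and> B = B' \<and> C = C' \<and> D = D'"
  by (auto simp: blockmat_def vec_eq_iff all_sum_type)

lemma rotv_blockmat: "rotv (blockmat A B C D *v x) = A *v rotv x + B *v transv x"
  and transv_blockmat: "transv (blockmat A B C D *v x) = C *v rotv x + D *v transv x"
  by (auto simp: blockmat_def rotv_def transv_def matrix_vector_mult_def vec_eq_iff sum_UNIV_Plus)

lemma vec6_eqI: "rotv x = rotv y \<Longrightarrow> transv x = transv y \<Longrightarrow> x = y"
  by (auto simp: rotv_def transv_def vec_eq_iff all_sum_type)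

lemma rotv_simps [simp]:
  "rotv 0 = 0" "rotv (x + y) = rotv x + rotv y" "rotv (x - y) = rotv x - rotv y"
  "rotv (c *\<^sub>R x) = c *\<^sub>R rotv x" "rotv (- x) = - rotv x"
  by (auto simp: rotv_def vec_eq_iff)

lemma transv_simps [simp]:
  "transv 0 = 0" "transv (x + y) = transv x + transv y" "transv (x - y) = transv x - transv y"
  "transv (c *\<^sub>R x) = c *\<^sub>R transv x" "transv (- x) = - transv x"
  by (auto simp: transv_def vec_eq_iff)

lemma bounded_linear_rotv: "bounded_linear rotv" and bounded_linear_transv: "bounded_linear transv"
  by (auto intro!: linear_conv_bounded_linear[THEN iffD1] linearI)

definition vec6 :: "real^3 \<Rightarrow> real^3 \<Rightarrow> real^(3 + 3)" where
  "vec6 a b = (\<chi> i. case i of Inl j \<Rightarrow> a $ j | Inr j \<Rightarrow> b $ j)"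

lemma rotv_vec6 [simp]: "rotv (vec6 a b) = a" and transv_vec6 [simp]: "transv (vec6 a b) = b"
  by (auto simp: vec6_def rotv_def transv_def vec_eq_iff)

lemma bounded_linear_vec6: "bounded_linear (\<lambda>z. vec6 (fst z) (snd z))"
  by (auto intro!: linear_conv_bounded_linear[THEN iffD1] linearI vec6_eqI)

lemma inner_vec6: "x \<bullet> y = rotv x \<bullet> rotv y + transv x \<bullet> transv y"
  by (auto simp: inner_vec_def rotv_def transv_def sum_UNIV_Plus)

lemma skew_mult [simp]: "skew a *v x = a \<times> x"
  by (simp add: skew_def matrix_works bilinear_cross[unfolded bilinear_def])

lemma uminus_matrix_vector_mult: "(- A) *v x = - (A *v x)" for A :: "real^'n^'m"
  by (simp add: matrix_vector_mult_def vec_eq_iff sum_negf)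

lemma skew_simps:
  "skew 0 = 0" "skew (a + b) = skew a + skew b" "skew (a - b) = skew a - skew b"
  "skew (c *\<^sub>R a) = c *\<^sub>R skew a" "skew (- a) = - skew a"
  by (simp_all add: matrix_eq cross_add_left Cross3.left_diff_distrib cross_mult_left
      matrix_vector_mult_add_rdistrib matrix_vector_mult_diff_rdistrib scaleR_matrix_vector_assoc[symmetric]
      uminus_matrix_vector_mult)

lemma bounded_linear_skew: "bounded_linear skew"
  by (auto intro!: linear_conv_bounded_linear[THEN iffD1] linearI simp: skew_simps)

lemma skew_component: "skew a $ i $ j = (a \<times> axis j 1) $ i"
  by (simp add: skew_def matrix_def)

lemma skew_eq_iff: "skew a = skew b \<longleftrightarrow> a = b"
  by (auto simp: vec_eq_iff skew_component cross3_def axis_def forall_3)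

lemma transpose_skew: "transpose (skew a) = - skew a"
  by (simp add: vec_eq_iff transpose_def skew_component cross3_def axis_def forall_3)

lemma columnvector_simps:
  "columnvector 0 = 0" "columnvector (x + y) = columnvector x + columnvector y"
  "columnvector (x - y) = columnvector x - columnvector y"
  "columnvector (c *\<^sub>R x) = c *\<^sub>R columnvector x" "columnvector (- x) = - columnvector x"
  for x y :: "real^'n"
  by (simp_all add: columnvector_def vec_eq_iff)

lemma columnvector_eq_iff: "columnvector x = columnvector y \<longleftrightarrow> x = y"
  by (simp add: columnvector_def vec_eq_iff)

lemma vee_eq_iff: "vee x = vee y \<longleftrightarrow> x = y"
  by (auto simp: vee_def blockmat_eq_iff skew_eq_iff columnvector_eq_iff intro!: vec6_eqI)

lemma vee_simps:
  "vee 0 = 0" "vee (x + y) = vee x + vee y" "vee (x - y) = vee x - vee y"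
  "vee (c *\<^sub>R x) = c *\<^sub>R vee x" "vee (- x) = - vee x"
  by (auto simp: vee_def blockmat_add blockmat_diff blockmat_scaleR skew_simps columnvector_simps)
     (auto simp: blockmat_def vec_eq_iff all_sum_type)

subsection \<open>Poses\<close>

definition pose :: "real^3^3 \<Rightarrow> real^3 \<Rightarrow> real^(3 + 1)^(3 + 1)" where
  "pose R b = blockmat R (columnvector b) 0 (mat 1)"

lemma pose_mult: "pose R b ** pose R' b' = pose (R ** R') (R *v b' + b)"
  by (simp add: pose_def blockmat_mult columnvector_simps dot_rowvector_columnvector)

lemma pose_mult_vee: "pose R b ** vee \<zeta> = blockmat (R ** skew (rotv \<zeta>)) (columnvector (R *v transv \<zeta>)) 0 0"
  by (simp add: pose_def vee_def blockmat_mult dot_rowvector_columnvector)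

lemma rotm_pose [simp]: "rotm (pose R b) = R" and posv_pose [simp]: "posv (pose R b) = b"
  by (simp_all add: pose_def rotm_def posv_def blockmat_def columnvector_def vec_eq_iff)

lemma pose_eq_iff: "pose R b = pose R' b' \<longleftrightarrow> R = R' \<and> b = b'"
  by (auto simp: pose_def blockmat_eq_iff columnvector_eq_iff)

lemma pose_1: "pose (mat 1) 0 = mat 1"
  by (simp add: pose_def columnvector_simps mat_1_blockmat[symmetric])

lemma SE3_iff: "h \<in> SE3 \<longleftrightarrow> rotation_matrix (rotm h) \<and> h = pose (rotm h) (posv h)"
  unfolding SE3_def pose_def[symmetric] by auto

lemma bounded_linear_rotm: "bounded_linear rotm" and bounded_linear_posv: "bounded_linear posv"
  by (auto intro!: linear_conv_bounded_linear[THEN iffD1] linearI simp: rotm_def posv_def vec_eq_iff)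

lemma rotation_matrix_transpose: "rotation_matrix R \<Longrightarrow> rotation_matrix (transpose R)"
  by (simp add: rotation_matrix_def)

lemma rotation_matrix_mult: "rotation_matrix R \<Longrightarrow> rotation_matrix Q \<Longrightarrow> rotation_matrix (R ** Q)"
  for R Q :: "real^'n^'n"
  by (simp add: rotation_matrix_def det_mul orthogonal_matrix_mul)

lemma rotation_matrix_inverse:
  "rotation_matrix R \<Longrightarrow> transpose R ** R = mat 1" "rotation_matrix R \<Longrightarrow> R ** transpose R = mat 1"
  by (simp_all add: rotation_matrix_def orthogonal_matrix_def)

lemma pose_inverse:
  assumes "rotation_matrix R"
  shows "pose R b ** pose (transpose R) (- (transpose R *v b)) = mat 1"
    and "pose (transpose R) (- (transpose R *v b)) ** pose R b = mat 1"
  using rotation_matrix_inverse[OF assms]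
  by (simp_all add: pose_mult pose_1 matrix_vector_mul_assoc vec.neg del: transpose_matrix_vector)

lemma matrix_inv_eqI: "A ** B = mat 1 \<Longrightarrow> B ** A = mat 1 \<Longrightarrow> matrix_inv A = B" for A B :: "real^'n^'n"
  unfolding matrix_inv_def
  by (rule some_equality, blast) (metis matrix_mul_assoc matrix_mul_lid matrix_mul_rid)

lemma matrix_inv_pose:
  "rotation_matrix R \<Longrightarrow> matrix_inv (pose R b) = pose (transpose R) (- (transpose R *v b))"
  by (intro matrix_inv_eqI pose_inverse)

lemma SE3_inverse:
  assumes "h \<in> SE3"
  shows "matrix_inv h = pose (transpose (rotm h)) (- (transpose (rotm h) *v posv h))"
    and "matrix_inv h \<in> SE3" and "h ** matrix_inv h = mat 1" and "matrix_inv h ** h = mat 1"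
proof -
  have R: "rotation_matrix (rotm h)" and h: "h = pose (rotm h) (posv h)" using assms by (simp_all add: SE3_iff)
  show eq: "matrix_inv h = pose (transpose (rotm h)) (- (transpose (rotm h) *v posv h))"
    by (subst h) (rule matrix_inv_pose[OF R])
  show "matrix_inv h \<in> SE3" unfolding eq by (simp add: SE3_iff rotation_matrix_transpose R)
  show "h ** matrix_inv h = mat 1" "matrix_inv h ** h = mat 1" unfolding eq using h pose_inverse[OF R] by metis+
qed

lemma SE3_mult: "g \<in> SE3 \<Longrightarrow> h \<in> SE3 \<Longrightarrow> g ** h \<in> SE3"
  by (metis SE3_iff pose_mult posv_pose rotation_matrix_mult rotm_pose)

text \<open>Rotations preserve cross products, so conjugation sends \<open>skew w\<close> to
  \<open>skew (R *v w)\<close>. The position b then adds \<open>b \<times> (R *v w)\<close> to the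
  translational part, which accounts for the lower left block of \<open>Ad\<close>.\<close>

lemma SE3_vee_mult_inverse:
  assumes "g \<in> SE3"
  shows "g ** vee \<zeta> ** matrix_inv g = vee (Ad g *v \<zeta>)"
proof -
  define R b where "R = rotm g" and "b = posv g"
  have R: "rotation_matrix R" and g: "g = pose R b" using assms by (auto simp: SE3_iff R_def b_def)
  have RR: "R *v (transpose R *v x) = x" for x
    by (simp add: matrix_vector_mul_assoc rotation_matrix_inverse[OF R] del: transpose_matrix_vector)
  have conj: "R ** skew w ** transpose R = skew (R *v w)" for w
  proof (subst matrix_eq, rule allI)
    fix x
    have "R *v (w \<times> (transpose R *v x)) = (R *v w) \<times> (R *v (transpose R *v x))"
      by (simp add: cross_rotation_matrix[OF R])
    then show "(R ** skew w ** transpose R) *v x = skew (R *v w) *v x"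
      by (simp only: matrix_vector_mul_assoc[symmetric] skew_mult RR)
  qed
  have "g ** vee \<zeta> ** matrix_inv g =
      blockmat (R ** skew (rotv \<zeta>) ** transpose R)
        (columnvector ((R ** skew (rotv \<zeta>)) *v (- (transpose R *v b)) + R *v transv \<zeta>)) 0 0"
    unfolding g matrix_inv_pose[OF R] pose_mult_vee
    by (simp add: pose_def blockmat_mult columnvector_simps dot_rowvector_columnvector)
  also have "(R ** skew (rotv \<zeta>)) *v (- (transpose R *v b)) = b \<times> (R *v rotv \<zeta>)"
  proof -
    have "(R ** skew (rotv \<zeta>)) *v (- (transpose R *v b)) = - ((R ** skew (rotv \<zeta>) ** transpose R) *v b)"
      by (simp add: vec.neg matrix_vector_mul_assoc del: transpose_matrix_vector)
    then show ?thesis by (simp add: conj cross_skew[of b])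
  qed
  finally show ?thesis
    by (simp add: conj vee_def Ad_def rotv_blockmat transv_blockmat g matrix_vector_mul_assoc[symmetric])
qed

lemma blockmat_0: "blockmat 0 0 0 0 = 0"
  by (simp add: blockmat_def vec_eq_iff all_sum_type)

subsection \<open>Polynomials in a skew matrix\<close>

text \<open>Rodrigues rotations, \<open>Amat\<close> and \<open>Smat\<close> all have this shape. By
  Cayley-Hamilton the cube of \<open>skew \<Theta>\<close> is a multiple of
  \<open>skew \<Theta>\<close>, so the family is closed under products, and matrix identities reduce
  to two scalar ones.\<close>

definition skew_poly :: "real \<Rightarrow> real \<Rightarrow> real^3 \<Rightarrow> real^3^3" where
  "skew_poly a b \<Theta> = mat 1 + a *\<^sub>R skew \<Theta> + b *\<^sub>R (skew \<Theta> ** skew \<Theta>)"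

lemma matrix_mult_scaleR_right: "A ** (c *\<^sub>R B) = c *\<^sub>R (A ** B)" for B :: "real^'n^'m"
  by (simp add: matrix_scalar_ac scalar_matrix_assoc)

lemma skew_poly_mult_vec: "skew_poly a b \<Theta> *v x = x + a *\<^sub>R (\<Theta> \<times> x) + b *\<^sub>R (\<Theta> \<times> (\<Theta> \<times> x))"
  by (simp add: skew_poly_def matrix_vector_mult_add_rdistrib scaleR_matrix_vector_assoc[symmetric]
      matrix_vector_mul_assoc[symmetric])

lemma cross_cross_cross: "\<Theta> \<times> (\<Theta> \<times> (\<Theta> \<times> x)) = - (\<Theta> \<bullet> \<Theta>) *\<^sub>R (\<Theta> \<times> x)"
  by (simp add: cross3_def vec_eq_iff inner_vec_def sum_3 forall_3) (intro conjI; algebra)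

lemma skew_cube: "skew \<Theta> ** (skew \<Theta> ** skew \<Theta>) = - (\<Theta> \<bullet> \<Theta>) *\<^sub>R skew \<Theta>"
  by (simp add: matrix_eq matrix_vector_mul_assoc[symmetric] cross_cross_cross scaleR_matrix_vector_assoc[symmetric]
     uminus_matrix_vector_mult)

lemma skew_poly_skew_poly_vec:
  "skew_poly a b \<Theta> *v (skew_poly c d \<Theta> *v x) =
   skew_poly (a + c - (\<Theta> \<bullet> \<Theta>) * (a * d + b * c)) (b + d + a * c - (\<Theta> \<bullet> \<Theta>) * (b * d)) \<Theta> *v x"
  by (simp add: skew_poly_mult_vec cross_add_right cross_mult_right cross_cross_cross algebra_simps)

lemma skew_poly_mult:
  "skew_poly a b \<Theta> ** skew_poly c d \<Theta> =
   skew_poly (a + c - (\<Theta> \<bullet> \<Theta>) * (a * d + b * c)) (b + d + a * c - (\<Theta> \<bullet> \<Theta>) * (b * d)) \<Theta>"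
  by (simp add: matrix_eq matrix_vector_mul_assoc[symmetric] skew_poly_skew_poly_vec)

lemma skew_poly_uminus: "skew_poly a b (- \<Theta>) = skew_poly (- a) b \<Theta>"
  by (simp add: matrix_eq skew_poly_mult_vec)

lemma transpose_add: "transpose (A + B) = transpose A + transpose B"
  by (simp add: transpose_def vec_eq_iff)

lemma transpose_skew_poly: "transpose (skew_poly a b \<Theta>) = skew_poly (- a) b \<Theta>"
proof -
  have "(- A) ** (- B) = A ** B" for A B :: "real^3^3"
    by (simp add: matrix_matrix_mult_def)
  then show ?thesis
    by (simp add: skew_poly_def transpose_add transpose_scalar matrix_transpose_mul transpose_skew)
qed

lemma skew_poly_fixes_axis: "skew_poly a b \<Theta> *v \<Theta> = \<Theta>"
  by (simp add: skew_poly_mult_vec)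

lemma skew_poly_0 [simp]: "skew_poly a b 0 = mat 1"
  by (simp add: skew_poly_def skew_simps)

lemma trace_skew_poly: "trace (skew_poly a b \<Theta>) = 3 - 2 * b * (\<Theta> \<bullet> \<Theta>)"
  by (simp add: skew_poly_def trace_def sum_3 matrix_matrix_mult_def skew_component cross3_def
      axis_def mat_def inner_vec_def algebra_simps)

text \<open>The vector of the skew-symmetric part of R; for a rotation it is the unit axis times the
  sine of the angle.\<close>

definition axial :: "real^3^3 \<Rightarrow> real^3" where
  "axial R = (1/2) *\<^sub>R vector [R$3$2 - R$2$3, R$1$3 - R$3$1, R$2$1 - R$1$2]"

lemma axial_skew_poly: "axial (skew_poly a b \<Theta>) = a *\<^sub>R \<Theta>"
  by (simp add: axial_def skew_poly_def sum_3 matrix_matrix_mult_def skew_component cross3_def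
      axis_def mat_def vec_eq_iff forall_3 algebra_simps)

section \<open>Scalar coefficients and the Jacobians of the rotation exponential\<close>

definition coefC :: "real \<Rightarrow> real" where "coefC \<theta> = sin \<theta> / \<theta>"
definition coefS :: "real \<Rightarrow> real" where "coefS \<theta> = (1 - cos \<theta>) / \<theta>^2"
definition coefD :: "real \<Rightarrow> real" where "coefD \<theta> = (\<theta> - sin \<theta>) / \<theta>^3"

lemma Amat_eq: "Amat \<Theta> = skew_poly (1/2) (coefA (norm \<Theta>)) \<Theta>"
  by (simp add: Amat_def skew_poly_def)

lemma Smat_eq: "Smat \<Theta> = skew_poly (coefS (norm \<Theta>)) (coefD (norm \<Theta>)) \<Theta>"
  by (simp add: Smat_def skew_poly_def Let_def coefS_def coefD_def)

definition rodrigues :: "real^3 \<Rightarrow> real^3^3" where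
  "rodrigues \<Theta> = skew_poly (coefC (norm \<Theta>)) (coefS (norm \<Theta>)) \<Theta>"

text \<open>
  With \<open>\<tau> = \<theta> cot (\<theta>/2)\<close> and \<open>D = \<theta>\<^sup>2 + \<tau>\<^sup>2\<close>, all the coefficients are rational functions of
  \<open>\<theta>\<^sup>2\<close> and \<open>\<tau>\<close>.  Identities between them thus become identities of polynomials without side
  relations.
\<close>

lemma coefficients_half_angle:
  assumes "0 < \<theta>" "\<theta> < pi"
  obtains \<tau> D where "D = \<theta>^2 + \<tau>^2" "0 < D"
    "sin \<theta> = 2 * \<tau> * \<theta> / D" "cos \<theta> = (\<tau>^2 - \<theta>^2) / D"
    "coefC \<theta> = 2 * \<tau> / D" "coefS \<theta> = 2 / D" "coefD \<theta> = (D - 2 * \<tau>) / (\<theta>^2 * D)"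
    "coefA \<theta> = (2 - \<tau>) / (2 * \<theta>^2)"
    "(1 + cos \<theta>) * (\<theta> - sin \<theta>) / (2 * \<theta> * (sin \<theta>)^2) = (D - 2 * \<tau>) / (4 * \<theta>^2)"
    "(1 + cos \<theta>) * (\<theta> + sin \<theta>) / (2 * \<theta>^3 * (sin \<theta>)^2) - 2 / \<theta>^4 = (D + 2 * \<tau> - 8) / (4 * \<theta>^4)"
proof -
  define \<tau> where "\<tau> = \<theta> * (1 + cos \<theta>) / sin \<theta>"
  define D where "D = \<theta>^2 + \<tau>^2"
  have s: "sin \<theta> > 0" using assms by (simp add: sin_gt_zero)
  have D0: "D > 0" using assms by (simp add: D_def add_pos_nonneg)
  have c: "cos \<theta> \<noteq> 1" using s sin_squared_eq[of \<theta>] by auto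
  have t0: "\<tau> * sin \<theta> = \<theta> * (1 + cos \<theta>)" using s by (simp add: \<tau>_def)
  have sc: "sin \<theta> ^ 2 = (1 - cos \<theta>) * (1 + cos \<theta>)"
    using sin_cos_squared_add[of \<theta>] by (simp add: algebra_simps power2_eq_square)
  have t1: "\<tau> * (1 - cos \<theta>) = \<theta> * sin \<theta>"
  proof -
    have "sin \<theta> * (\<tau> * (1 - cos \<theta>)) = sin \<theta> * (\<theta> * sin \<theta>)"
      using t0 sc by algebra
    then show ?thesis using s by simp
  qed
  have D1: "D * (1 - cos \<theta>) = 2 * \<theta>^2"
    using t0 t1 sc unfolding D_def by algebra
  have sD: "sin \<theta> * D = 2 * \<tau> * \<theta>"
  proof -
    have "(1 - cos \<theta>) * (sin \<theta> * D) = (1 - cos \<theta>) * (2 * \<tau> * \<theta>)"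
      using D1 t1 by algebra
    then show ?thesis using c by simp
  qed
  have cD: "cos \<theta> * D = \<tau>^2 - \<theta>^2" using D1 unfolding D_def by algebra
  have e1: "sin \<theta> = 2 * \<tau> * \<theta> / D" and e2: "cos \<theta> = (\<tau>^2 - \<theta>^2) / D"
    using sD cD D0 by (simp_all add: field_simps)
  \<comment> \<open>\<tau> is cancelled in the last three formulas. It would vanish at \<theta> =
    pi, whence the strict bound on the angle.\<close>
  have \<tau>0: "\<tau> > 0" using e1 s assms D0 by (simp add: zero_less_mult_iff zero_less_divide_iff)
  have e3: "1 - cos \<theta> = 2 * \<theta>^2 / D" using D1 D0 by (simp add: field_simps)
  have "D * (1 + cos \<theta>) = 2 * \<tau>^2" using D1 unfolding D_def by algebra
  then have e4: "1 + cos \<theta> = 2 * \<tau>^2 / D" using D0 by (simp add: field_simps)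
  have r1: "coefC \<theta> = 2 * \<tau> / D" using assms D0 by (simp add: coefC_def e1)
  have r2: "coefS \<theta> = 2 / D" using assms D0 by (simp add: coefS_def e3)
  have r3: "coefD \<theta> = (D - 2 * \<tau>) / (\<theta>^2 * D)"
    using assms D0 by (simp add: coefD_def e1 field_simps power2_eq_square power3_eq_cube)
  have r4: "coefA \<theta> = (2 - \<tau>) / (2 * \<theta>^2)"
    using assms D0 \<tau>0 unfolding coefA_def e4 e1 by (simp add: field_simps power2_eq_square)
  have r5: "(1 + cos \<theta>) * (\<theta> - sin \<theta>) / (2 * \<theta> * (sin \<theta>)^2) = (D - 2 * \<tau>) / (4 * \<theta>^2)"
    using assms D0 \<tau>0 unfolding e4 e1 by (simp add: field_simps power2_eq_square)
  have r6: "(1 + cos \<theta>) * (\<theta> + sin \<theta>) / (2 * \<theta>^3 * (sin \<theta>)^2) - 2 / \<theta>^4 = (D + 2 * \<tau> - 8) / (4 * \<theta>^4)"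
    using assms D0 \<tau>0 unfolding e4 e1 by (simp add: field_simps power2_eq_square power3_eq_cube power4_eq_xxxx)
  show thesis by (rule that[OF D_def D0 e1 e2 r1 r2 r3 r4 r5 r6])
qed

text \<open>\<open>Smat \<Theta>\<close> is the left Jacobian of the rotation exponential,
  \<open>Smat (- \<Theta>)\<close> is the right one, and \<open>Amat \<Theta>\<close> inverts the
  latter. In the product of the two polynomials it suffices that the two nonconstant coefficients
  vanish.\<close>

lemma Smat_Amat_uminus:
  assumes "norm \<Theta> < pi"
  shows "Smat \<Theta> ** Amat (- \<Theta>) = mat 1" "Amat (- \<Theta>) ** Smat \<Theta> = mat 1"
proof -
  have "skew_poly a b \<Theta> ** skew_poly c d \<Theta> = mat 1"
    if "a + c - (\<Theta> \<bullet> \<Theta>) * (a * d + b * c) = 0" "b + d + a * c - (\<Theta> \<bullet> \<Theta>) * (b * d) = 0" for a b c d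
    unfolding skew_poly_mult that by (simp add: skew_poly_def)
  moreover have "coefS \<theta> - 1/2 - \<theta>^2 * (coefS \<theta> * coefA \<theta> - coefD \<theta> / 2) = 0
      \<and> coefD \<theta> + coefA \<theta> - coefS \<theta> / 2 - \<theta>^2 * (coefD \<theta> * coefA \<theta>) = 0" if \<theta>: "0 < \<theta>" "\<theta> < pi" for \<theta>
  proof -
    from \<theta> obtain \<tau> D where DD: "D = \<theta>^2 + \<tau>^2" and D: "0 < D" and
    *: "coefS \<theta> = 2 / D" "coefD \<theta> = (D - 2 * \<tau>) / (\<theta>^2 * D)" "coefA \<theta> = (2 - \<tau>) / (2 * \<theta>^2)"
      by (rule coefficients_half_angle)
    have "2 / D - 1/2 - \<theta>^2 * (2 / D * ((2 - \<tau>) / (2 * \<theta>^2)) - (D - 2 * \<tau>) / (\<theta>^2 * D) / 2) = 0"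
      using \<theta> D by (simp add: divide_simps)
    moreover have "(D - 2 * \<tau>) / (\<theta>^2 * D) + (2 - \<tau>) / (2 * \<theta>^2) - 2 / D / 2
        - \<theta>^2 * ((D - 2 * \<tau>) / (\<theta>^2 * D) * ((2 - \<tau>) / (2 * \<theta>^2))) = 0"
      using \<theta> D by (simp add: divide_simps) (simp add: DD algebra_simps power2_eq_square)
    ultimately show ?thesis unfolding * by blast
  qed
  ultimately show "Smat \<Theta> ** Amat (- \<Theta>) = mat 1" "Amat (- \<Theta>) ** Smat \<Theta> = mat 1"
    using assms
    by (cases "\<Theta> = 0"; simp add: Smat_eq Amat_eq skew_poly_uminus power2_norm_eq_inner[symmetric]; simp add: algebra_simps)+
qed

text \<open>The left Jacobian is the rotation times the right Jacobian. This moves translations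
  between the two frames, both when a pose is inverted and when it is differentiated.\<close>

lemma rodrigues_Smat_uminus:
  assumes "norm \<Theta> < pi"
  shows "rodrigues \<Theta> ** Smat (- \<Theta>) = Smat \<Theta>"
proof (cases "\<Theta> = 0")
  case True
  then show ?thesis by (simp add: rodrigues_def Smat_eq)
next
  case False
  define \<theta> where "\<theta> = norm \<Theta>"
  have \<theta>: "0 < \<theta>" "\<theta> < pi" using False assms by (simp_all add: \<theta>_def)
  then obtain \<tau> D where DD: "D = \<theta>^2 + \<tau>^2" and D: "0 < D" and
    *: "coefC \<theta> = 2 * \<tau> / D" "coefS \<theta> = 2 / D" "coefD \<theta> = (D - 2 * \<tau>) / (\<theta>^2 * D)"
    by (rule coefficients_half_angle)
  have "coefC \<theta> - coefS \<theta> - \<theta>^2 * (coefC \<theta> * coefD \<theta> - coefS \<theta> * coefS \<theta>) = coefS \<theta>"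
  proof -
    have "2 * \<tau> / D - 2 / D - \<theta>^2 * (2 * \<tau> / D * ((D - 2 * \<tau>) / (\<theta>^2 * D)) - 2 / D * (2 / D)) = 2 / D"
      using \<theta> D by (simp add: divide_simps) (simp add: DD algebra_simps power2_eq_square)
    then show ?thesis unfolding * .
  qed
  moreover have "coefS \<theta> + coefD \<theta> - coefC \<theta> * coefS \<theta> - \<theta>^2 * (coefS \<theta> * coefD \<theta>) = coefD \<theta>"
    unfolding * using \<theta> D by (simp add: field_simps power2_eq_square)
  ultimately show ?thesis
    by (simp add: rodrigues_def Smat_eq skew_poly_uminus skew_poly_mult \<theta>_def[symmetric]
        power2_norm_eq_inner[symmetric]) (simp add: algebra_simps)
qed

subsection \<open>The exponential\<close>

definition pose_exp :: "real^(3 + 3) \<Rightarrow> real^(3 + 1)^(3 + 1)" where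
  "pose_exp \<eta> = pose (rodrigues (rotv \<eta>)) (Smat (rotv \<eta>) *v transv \<eta>)"

text \<open>X = \<open>vee \<eta>\<close> satisfies X^4 = - \<theta>^2 X^2. The cubic relation of
  its rotation block fails for X itself when the translation has a component along the axis, so X^2
  and X^3 are both kept: from the second power on, even powers are multiples of X^2 and odd ones of
  X^3. Their coefficients form the cosine and sine series without the leading terms.\<close>

lemma expm_vee: "expm (vee \<eta>) = pose_exp \<eta>"
proof -
  define X where "X = vee \<eta>"
  define \<Theta> \<beta> \<theta> where "\<Theta> = rotv \<eta>" and "\<beta> = transv \<eta>" and "\<theta> = norm (rotv \<eta>)"
  define f where "f n = ((\<lambda>Y. X ** Y) ^^ n) (mat 1)" for n
  have X2: "X ** X = blockmat (skew \<Theta> ** skew \<Theta>) (columnvector (\<Theta> \<times> \<beta>)) 0 0"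
    by (simp add: X_def vee_def columnvector_simps(1) blockmat_mult \<Theta>_def \<beta>_def dot_rowvector_columnvector[symmetric])
  have X3: "X ** (X ** X) = blockmat (- (\<theta>^2) *\<^sub>R skew \<Theta>) (columnvector (\<Theta> \<times> (\<Theta> \<times> \<beta>))) 0 0"
    unfolding X2 by (simp add: columnvector_simps(1) X_def vee_def blockmat_mult \<Theta>_def \<beta>_def \<theta>_def dot_rowvector_columnvector[symmetric] skew_cube
         power2_norm_eq_inner)
  have X4: "X ** (X ** (X ** X)) = - (\<theta>^2) *\<^sub>R (X ** X)"
  proof -
    have "X ** (X ** (X ** X)) = blockmat (skew \<Theta> ** (- (\<theta>^2) *\<^sub>R skew \<Theta>)) (columnvector (\<Theta> \<times> (\<Theta> \<times> (\<Theta> \<times> \<beta>)))) 0 0"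
      unfolding X3 by (simp add: columnvector_simps(1) X_def vee_def blockmat_mult \<Theta>_def dot_rowvector_columnvector[symmetric])
    also have "skew \<Theta> ** (- (\<theta>^2) *\<^sub>R skew \<Theta>) = - (\<theta>^2) *\<^sub>R (skew \<Theta> ** skew \<Theta>)"
      by (rule matrix_mult_scaleR_right)
    also have "\<Theta> \<times> (\<Theta> \<times> (\<Theta> \<times> \<beta>)) = - (\<theta>^2) *\<^sub>R (\<Theta> \<times> \<beta>)"
      by (simp add: cross_cross_cross \<theta>_def \<Theta>_def power2_norm_eq_inner)
    finally show ?thesis unfolding X2 by (simp add: blockmat_scaleR columnvector_simps)
  qed
  have even: "f (2 * j + 2) = (- (\<theta>^2)) ^ j *\<^sub>R (X ** X)" for j
  proof (induction j)
    case 0 show ?case by (simp add: f_def numeral_2_eq_2)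
  next
    case (Suc j)
    have "f (2 * Suc j + 2) = X ** (X ** f (2 * j + 2))" by (simp add: f_def)
    then show ?case using X4 by (simp only: Suc matrix_mult_scaleR_right) simp
  qed
  have odd: "f (2 * j + 3) = (- (\<theta>^2)) ^ j *\<^sub>R (X ** (X ** X))" for j
  proof -
    have "f (2 * j + 3) = X ** f (2 * j + 2)" by (simp add: f_def eval_nat_numeral)
    then show ?thesis by (simp only: even matrix_mult_scaleR_right)
  qed
  \<comment> \<open>At \<theta> = 0 the quotients below are 0 by the convention x / 0 = 0, which is
    not their limit; the powers of X that they multiply vanish as well.\<close>
  have zero: "X ** X = 0" if "\<theta> = 0"
  proof -
    have "\<Theta> = 0" using that by (simp add: \<theta>_def \<Theta>_def)
    then show ?thesis unfolding X2 by (simp add: skew_simps columnvector_simps blockmat_0)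
  qed
  \<comment> \<open>One formula for all n, in which corrections with a single nonzero term remove
    the leading terms of both series; every summand then has a known sum.\<close>
  have coeff: "(1 / fact n) *\<^sub>R f n = (if n = 0 then mat 1 else 0) + (if n = 1 then X else 0)
      + (((if n = 0 then 1 else 0) - cos_coeff n *\<^sub>R \<theta> ^ n) / \<theta>^2) *\<^sub>R (X ** X)
      + (((if n = 1 then \<theta> else 0) - sin_coeff n *\<^sub>R \<theta> ^ n) / \<theta>^3) *\<^sub>R (X ** (X ** X))" for n
  proof -
    consider "n = 0" | "n = 1" | j where "n = 2 * j + 2" | j where "n = 2 * j + 3"
    proof -
      assume *: "n = 0 \<Longrightarrow> thesis" "n = 1 \<Longrightarrow> thesis"  "\<And>j. n = 2 * j + 2 \<Longrightarrow> thesis" "\<And>j. n = 2 * j + 3 \<Longrightarrow> thesis"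
      have "n = 0 \<or> n = 1 \<or> n = 2 * ((n - 2) div 2) + 2 \<or> n = 2 * ((n - 2) div 2) + 3" by presburger
      then show thesis using * by blast
    qed
    then show ?thesis
    proof cases
      case 1 then show ?thesis by (simp add: f_def cos_coeff_def sin_coeff_def)
    next
      case 2 then show ?thesis by (simp add: f_def cos_coeff_def sin_coeff_def)
    next
      case (3 j)
      have "- (cos_coeff n * \<theta> ^ n) / \<theta>^2 = (- (\<theta>^2)) ^ j / fact n" if "\<theta> \<noteq> 0"
      proof -
        have "cos_coeff n = - ((- 1) ^ j / fact n)" by (simp add: 3 cos_coeff_def)
        moreover have "\<theta> ^ n = (\<theta>^2) ^ j * \<theta>^2" by (simp add: 3 power_mult[symmetric] power_add[symmetric])
        ultimately show ?thesis using that by (simp add: power_minus[of "\<theta>^2"])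
      qed
      then show ?thesis using zero even[of j]
        by (cases "\<theta> = 0") (simp_all add: 3 sin_coeff_def)
    next
      case (4 j)
      have "- (sin_coeff n * \<theta> ^ n) / \<theta>^3 = (- (\<theta>^2)) ^ j / fact n" if "\<theta> \<noteq> 0"
      proof -
        have "sin_coeff n = - ((- 1) ^ j / fact n)" by (simp add: 4 sin_coeff_def)
        moreover have "\<theta> ^ n = (\<theta>^2) ^ j * \<theta>^3" by (simp add: 4 power_mult[symmetric] power_add[symmetric])
        ultimately show ?thesis using that by (simp add: power_minus[of "\<theta>^2"])
      qed
      then show ?thesis using zero odd[of j]
        by (cases "\<theta> = 0") (simp_all add: 4 cos_coeff_def)
    qed
  qed
  have "(\<lambda>n. (1 / fact n) *\<^sub>R f n) sums (mat 1 + X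
      + ((1 - cos \<theta>) / \<theta>^2) *\<^sub>R (X ** X) + ((\<theta> - sin \<theta>) / \<theta>^3) *\<^sub>R (X ** (X ** X)))"
    unfolding coeff
    by (intro sums_add sums_scaleR_left sums_divide sums_diff sums_single cos_converges sin_converges)
       
  then have "expm X = mat 1 + X + coefS \<theta> *\<^sub>R (X ** X) + coefD \<theta> *\<^sub>R (X ** (X ** X))"
    unfolding expm_def f_def[symmetric] coefS_def coefD_def by (rule sums_unique[symmetric])
  also have "\<dots> = pose_exp \<eta>"
  proof -
    \<comment> \<open>X and X^3 both contribute to the first power of \<open>skew \<Theta>\<close>,
      as its cube reduces; together they give sin \<theta> / \<theta>.\<close>
    have *: "1 - coefD \<theta> * \<theta>^2 = coefC \<theta>" if "\<theta> \<noteq> 0"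
      using that by (simp add: coefD_def coefC_def field_simps power2_eq_square power3_eq_cube)
    have "skew \<Theta> - (coefD \<theta> * \<theta>^2) *\<^sub>R skew \<Theta> = coefC \<theta> *\<^sub>R skew \<Theta>"
    proof (cases "\<theta> = 0")
      case True
      then show ?thesis by (simp add: \<theta>_def \<Theta>_def skew_simps)
    next
      case False
      then show ?thesis by (simp add: *[symmetric] algebra_simps)
    qed
    then show ?thesis
      unfolding X3 unfolding X2 unfolding X_def pose_exp_def
      by (simp add: vee_def pose_def mat_1_blockmat[where 'a=3 and 'b=1]
          \<Theta>_def[symmetric] \<theta>_def[symmetric] \<beta>_def[symmetric]
          blockmat_add blockmat_scaleR blockmat_eq_iff columnvector_simps(2-5)[symmetric] columnvector_eq_iff
          rodrigues_def Smat_eq skew_poly_mult_vec) (simp add: skew_poly_def \<theta>_def \<Theta>_def)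
  qed
  finally show ?thesis by (simp add: X_def)
qed

subsection \<open>The logarithm\<close>

text \<open>For a rotation by \<theta> about a unit vector n, the axial vector is sin \<theta> times
  n, the symmetric part of R is cos \<theta> I + (1 - cos \<theta>) n n^T, and (trace R - 1) / 2 is
  cos \<theta>; so both sides are sin^2 \<theta> times n_i n_j. The proof avoids finding an axis: it
  eliminates using the orthonormality of rows and columns and the cofactor relations.\<close>

lemma rotation_matrix_axial:
  fixes R :: "real^3^3"
  assumes R: "rotation_matrix R"
  shows "axial R $ i * axial R $ j =
    (1 + trace R) / 2 * ((R $ i $ j + R $ j $ i) / 2 - (if i = j then (trace R - 1) / 2 else 0))"
proof -
  have rows: "R$a$1 * R$b$1 + R$a$2 * R$b$2 + R$a$3 * R$b$3 = (if a = b then 1 else 0)" for a b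
    using arg_cong[OF rotation_matrix_inverse(2)[OF R], of "\<lambda>M. M $ a $ b"]
    by (simp add: matrix_matrix_mult_def transpose_def sum_3 mat_def)
  have cols: "R$1$a * R$1$b + R$2$a * R$2$b + R$3$a * R$3$b = (if a = b then 1 else 0)" for a b
    using arg_cong[OF rotation_matrix_inverse(1)[OF R], of "\<lambda>M. M $ a $ b"]
    by (simp add: matrix_matrix_mult_def transpose_def sum_3 mat_def)
  \<comment> \<open>As R preserves cross products, each entry of R equals its own cofactor; the nine
    instances are collected in \<open>k\<close>.\<close>
  have cof: "((R *v axis a 1) \<times> (R *v axis b 1)) $ c = (R *v (axis a 1 \<times> axis b 1)) $ c" for a b c
    using cross_rotation_matrix[OF R] by simp
  have Rx: "(R *v axis a 1) $ b = R $ b $ a" for a b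
    by (simp add: matrix_vector_mult_basis column_def)
  have k: "R$1$1 = R$2$2 * R$3$3 - R$3$2 * R$2$3" "R$2$2 = R$3$3 * R$1$1 - R$1$3 * R$3$1"
    "R$3$3 = R$1$1 * R$2$2 - R$2$1 * R$1$2"
    "R$1$2 = R$2$3 * R$3$1 - R$3$3 * R$2$1" "R$2$1 = R$3$2 * R$1$3 - R$1$2 * R$3$3"
    "R$1$3 = R$2$1 * R$3$2 - R$3$1 * R$2$2" "R$3$1 = R$1$2 * R$2$3 - R$2$2 * R$1$3"
    "R$2$3 = R$3$1 * R$1$2 - R$1$1 * R$3$2" "R$3$2 = R$1$3 * R$2$1 - R$2$3 * R$1$1"
    using cof[of 2 3 1] cof[of 3 1 2] cof[of 1 2 3] cof[of 3 1 1] cof[of 2 3 2] cof[of 1 2 1] cof[of 2 3 3]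
      cof[of 1 2 2] cof[of 3 1 3]
    by (simp_all add: cross_basis cross_components Rx vec.neg mult.commute)
  have t: "trace R = R$1$1 + R$2$2 + R$3$3" by (simp add: trace_def sum_3)
  have v: "axial R $ 1 = (R$3$2 - R$2$3) / 2" "axial R $ 2 = (R$1$3 - R$3$1) / 2" "axial R $ 3 = (R$2$1 - R$1$2) / 2"
    by (simp_all add: axial_def)
  have "(R$3$2 - R$2$3) * (R$3$2 - R$2$3) = (1 + trace R) * (2 * R$1$1 - trace R + 1)"
    using k(1) rows[of 2 2] rows[of 3 3] cols[of 1 1] unfolding t by (simp, algebra)
  moreover have "(R$1$3 - R$3$1) * (R$1$3 - R$3$1) = (1 + trace R) * (2 * R$2$2 - trace R + 1)"
    using k(2) rows[of 1 1] rows[of 3 3] cols[of 2 2] unfolding t by (simp, algebra)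
  moreover have "(R$2$1 - R$1$2) * (R$2$1 - R$1$2) = (1 + trace R) * (2 * R$3$3 - trace R + 1)"
    using k(3) rows[of 1 1] rows[of 2 2] cols[of 3 3] unfolding t by (simp, algebra)
  moreover have "(R$3$2 - R$2$3) * (R$1$3 - R$3$1) = (1 + trace R) * (R$1$2 + R$2$1)"
    using k(4,5) rows[of 1 2] cols[of 1 2] unfolding t by (simp, algebra)
  moreover have "(R$3$2 - R$2$3) * (R$2$1 - R$1$2) = (1 + trace R) * (R$1$3 + R$3$1)"
    using k(6,7) rows[of 1 3] cols[of 1 3] unfolding t by (simp, algebra)
  moreover have "(R$1$3 - R$3$1) * (R$2$1 - R$1$2) = (1 + trace R) * (R$2$3 + R$3$2)"
    using k(8,9) rows[of 2 3] cols[of 2 3] unfolding t by (simp, algebra)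
  moreover have "i = 1 \<or> i = 2 \<or> i = 3" "j = 1 \<or> j = 2 \<or> j = 3" using exhaust_3 by blast+
  ultimately show ?thesis by (elim disjE) (simp_all add: v mult.commute add.commute field_simps)
qed

text \<open>\<open>axial R\<close> has length sin \<theta>, so the factor rescales it to length
  \<theta>. The value 1 at \<theta> = 0 is the limit of \<theta> / sin \<theta>, which keeps the
  factor continuous there.\<close>

definition rotlog :: "real^3^3 \<Rightarrow> real^3" where
  "rotlog R = (let \<theta> = principal_angle R in (if \<theta> = 0 then 1 else \<theta> / sin \<theta>) *\<^sub>R axial R)"

text \<open>The trace of the preceding identity. It places (trace R - 1) / 2 in the domain of
  arccos.\<close>

lemma norm_axial:
  assumes "rotation_matrix R"
  shows "(norm (axial R))\<^sup>2 = 1 - ((trace R - 1) / 2)\<^sup>2"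
proof -
  have t: "trace R = R$1$1 + R$2$2 + R$3$3" by (simp add: trace_def sum_3)
  have "(norm (axial R))\<^sup>2 = axial R $ 1 * axial R $ 1 + axial R $ 2 * axial R $ 2 + axial R $ 3 * axial R $ 3"
    by (simp add: power2_norm_eq_inner inner_vec_def sum_3)
  also have "\<dots> = 1 - ((trace R - 1) / 2)\<^sup>2"
    unfolding rotation_matrix_axial[OF assms] using t by (simp add: field_simps power2_eq_square)
  finally show ?thesis .
qed

lemma skew_mult_skew: "(skew a ** skew a) $ i $ j = a $ i * a $ j - (if i = j then (norm a)\<^sup>2 else 0)"
proof -
  have "i = 1 \<or> i = 2 \<or> i = 3" "j = 1 \<or> j = 2 \<or> j = 3" using exhaust_3 by blast+
  then show ?thesis
    by (elim disjE) (simp_all add: matrix_matrix_mult_def sum_3 skew_component cross3_def axis_def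
      power2_norm_eq_inner inner_vec_def)
qed

lemma skew_axial: "skew (axial R) $ i $ j = (R $ i $ j - R $ j $ i) / 2"
proof -
  have "i = 1 \<or> i = 2 \<or> i = 3" "j = 1 \<or> j = 2 \<or> j = 3" using exhaust_3 by blast+
  then show ?thesis
    by (elim disjE) (simp_all add: skew_component cross3_def axis_def axial_def field_simps)
qed

text \<open>The skew part of R is \<open>skew (axial R)\<close>, and
  \<open>rotation_matrix_axial\<close> returns the symmetric part after division by 1 + cos
  \<theta>, which is nonzero because the angle stays below pi.\<close>

lemma rodrigues_rotlog:
  assumes R: "rotation_matrix R" and angle: "principal_angle R < pi"
  shows "rodrigues (rotlog R) = R" and "norm (rotlog R) = principal_angle R"
proof -
  define c \<theta> a where "c = (trace R - 1) / 2" and "\<theta> = principal_angle R" and "a = axial R"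
  have na: "(norm a)\<^sup>2 = 1 - c\<^sup>2" by (simp add: a_def c_def norm_axial[OF R])
  then have "c\<^sup>2 \<le> 1" by (metis diff_ge_0_iff_ge zero_le_power2)
  then have c1: "-1 \<le> c" "c \<le> 1" using abs_square_le_1[of c] by auto
  have \<theta>: "0 \<le> \<theta>" "\<theta> < pi" "cos \<theta> = c"
    using c1 angle by (simp_all add: \<theta>_def principal_angle_def c_def arccos_lbound)
  have s: "sin \<theta> = norm a"
  proof -
    have "(sin \<theta>)\<^sup>2 = (norm a)\<^sup>2" using na \<theta>(3) by (simp add: sin_squared_eq)
    moreover have "0 \<le> sin \<theta>" using \<theta> by (simp add: sin_ge_zero)
    ultimately show ?thesis by simp
  qed
  have comp: "a $ i * a $ j = (1 + c) * ((R $ i $ j + R $ j $ i) / 2 - (if i = j then c else 0))" for i j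
    unfolding a_def c_def rotation_matrix_axial[OF R] by (simp add: field_simps)
  have "rodrigues (rotlog R) = R \<and> norm (rotlog R) = \<theta>"
  proof (cases "\<theta> = 0")
    case True
    then have "c = 1" "a = 0" using \<theta> s by auto
    have "R $ i $ j = mat 1 $ i $ j" for i j
      using comp[of i j] skew_axial[of R i j] \<open>a = 0\<close> \<open>c = 1\<close> by (simp add: a_def[symmetric] skew_simps mat_def split: if_splits)
    then have "R = mat 1" by (simp add: vec_eq_iff)
    moreover have "rotlog R = 0" using \<open>a = 0\<close> by (simp add: rotlog_def Let_def a_def)
    ultimately show ?thesis using True by (simp add: rodrigues_def)
  next
    case False
    then have sp: "sin \<theta> > 0" using \<theta> by (simp add: sin_gt_zero)
    define \<Theta> where "\<Theta> = rotlog R"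
    have \<Theta>: "\<Theta> = (\<theta> / sin \<theta>) *\<^sub>R a" using False by (simp add: \<Theta>_def rotlog_def \<theta>_def[symmetric] a_def)
    have n: "norm \<Theta> = \<theta>" using sp \<theta> by (simp add: \<Theta> s[symmetric])
    have cp: "1 + c \<noteq> 0" using sp na s by (auto simp: power2_eq_square add_eq_0_iff)
    have e: "(1 - c) = (sin \<theta>)\<^sup>2 / (1 + c)" using cp na s by (simp add: field_simps power2_eq_square)
    have K: "coefS \<theta> * (\<theta> / sin \<theta>)^2 = 1 / (1 + c)"
      using False sp cp by (simp add: coefS_def \<theta>(3) e power2_eq_square)
    have "rodrigues \<Theta> $ i $ j = R $ i $ j" for i j
    proof -
      have "rodrigues \<Theta> $ i $ j = mat 1 $ i $ j + skew a $ i $ j + 1 / (1 + c) * (skew a ** skew a) $ i $ j"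
        using False sp K unfolding rodrigues_def n unfolding \<Theta> skew_poly_def 
        by (simp add: skew_simps coefC_def matrix_mult_scaleR_right scalar_matrix_assoc[symmetric] power2_eq_square)
      also have "\<dots> = R $ i $ j"
        unfolding skew_mult_skew comp na skew_axial[of R i j, folded a_def] using cp
        by (simp add: mat_def field_simps power2_eq_square)
      finally show ?thesis .
    qed
    then show ?thesis using n by (simp add: \<Theta>_def vec_eq_iff)
  qed
  then show "rodrigues (rotlog R) = R" and "norm (rotlog R) = principal_angle R" by (auto simp: \<theta>_def)
qed

text \<open>The trace of the Rodrigues rotation is 1 + 2 cos \<theta>, which determines \<theta>
  below pi; the axial vector then determines the direction.\<close>

lemma rotlog_rodrigues:
  assumes "norm \<Theta> < pi"
  shows "rotlog (rodrigues \<Theta>) = \<Theta>"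
proof -
  have "(trace (rodrigues \<Theta>) - 1) / 2 = cos (norm \<Theta>)"
    by (cases "\<Theta> = 0") (simp_all add: rodrigues_def trace_skew_poly coefS_def power2_norm_eq_inner[symmetric], simp add: trace_def mat_def)
  then have a: "principal_angle (rodrigues \<Theta>) = norm \<Theta>"
    using assms by (simp add: principal_angle_def arccos_cos)
  show "rotlog (rodrigues \<Theta>) = \<Theta>"
  proof (cases "\<Theta> = 0")
    case True
    then show ?thesis using a by (simp add: rotlog_def) (simp add: rodrigues_def axial_skew_poly[of 1 1 0, simplified])
  next
    case False
    then have "sin (norm \<Theta>) \<noteq> 0" using assms sin_gt_zero[of "norm \<Theta>"] by simp
    then show ?thesis using False a
      by (simp add: rotlog_def Let_def rodrigues_def axial_skew_poly coefC_def)
  qed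
qed

text \<open>\<open>Amat (- \<Theta>)\<close> undoes the factor \<open>Smat \<Theta>\<close> that
  \<open>pose_exp\<close> applies to the translation.\<close>

definition pose_log :: "real^(3 + 1)^(3 + 1) \<Rightarrow> real^(3 + 3)" where
  "pose_log h = vec6 (rotlog (rotm h)) (Amat (- rotlog (rotm h)) *v posv h)"

lemma pose_log_pose_exp:
  assumes "norm (rotv \<eta>) < pi"
  shows "pose_log (pose_exp \<eta>) = \<eta>"
  by (rule vec6_eqI) (simp_all add: pose_log_def pose_exp_def rotlog_rodrigues[OF assms]
      matrix_vector_mul_assoc Smat_Amat_uminus[OF assms])

lemma pose_exp_pose_log:
  assumes "h \<in> SE3" "principal_angle (rotm h) < pi"
  shows "pose_exp (pose_log h) = h" and "norm (rotv (pose_log h)) < pi"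
proof -
  have R: "rotation_matrix (rotm h)" and h: "h = pose (rotm h) (posv h)" using assms by (simp_all add: SE3_iff)
  show n: "norm (rotv (pose_log h)) < pi"
    using assms by (simp add: pose_log_def rodrigues_rotlog[OF R])
  show "pose_exp (pose_log h) = h"
    using n assms unfolding pose_exp_def
    by (subst (4) h) (simp add: pose_log_def rodrigues_rotlog[OF R] pose_eq_iff matrix_vector_mul_assoc Smat_Amat_uminus)
qed

text \<open>Existence and uniqueness for the definite description are the two inversion lemmas for
  \<open>pose_exp\<close> and \<open>pose_log\<close>.\<close>

lemma logm_eq:
  assumes "h \<in> SE3" "principal_angle (rotm h) < pi"
  shows "logm h = vee (pose_log h)"
  unfolding logm_def
proof (rule the_equality)
  show "\<exists>\<eta>. vee (pose_log h) = vee \<eta> \<and> norm (rotv \<eta>) < pi \<and> expm (vee (pose_log h)) = h"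
    using pose_exp_pose_log[OF assms] by (auto simp: expm_vee)
next
  fix X assume "\<exists>\<eta>. X = vee \<eta> \<and> norm (rotv \<eta>) < pi \<and> expm X = h"
  then show "X = vee (pose_log h)" by (auto simp: expm_vee pose_log_pose_exp)
qed

text \<open>Changing the sign of \<Theta> transposes the Rodrigues rotation, and the translations
  match by \<open>rodrigues_Smat_uminus\<close>. Membership in \<open>SE3\<close> supplies the
  orthogonality of the rotation block.\<close>

lemma pose_exp_uminus:
  assumes n: "norm (rotv \<eta>) < pi" and SE3: "pose_exp \<eta> \<in> SE3"
  shows "pose_exp (- \<eta>) = matrix_inv (pose_exp \<eta>)"
proof -
  define \<Theta> \<beta> R where "\<Theta> = rotv \<eta>" and "\<beta> = transv \<eta>" and "R = rodrigues \<Theta>"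
  have R: "rotation_matrix R" using SE3 by (simp add: SE3_iff pose_exp_def R_def \<Theta>_def)
  have T: "rodrigues (- \<Theta>) = transpose R"
    by (simp add: R_def rodrigues_def skew_poly_uminus transpose_skew_poly)
  have "transpose R *v (Smat \<Theta> *v \<beta>) = (transpose R ** R) *v (Smat (- \<Theta>) *v \<beta>)"
    by (simp only: rodrigues_Smat_uminus[symmetric, OF n[folded \<Theta>_def]] R_def matrix_vector_mul_assoc[symmetric])
  then have "transpose R *v (Smat \<Theta> *v \<beta>) = Smat (- \<Theta>) *v \<beta>"
    by (simp add: rotation_matrix_inverse[OF R] del: transpose_matrix_vector)
  then show ?thesis
    by (simp add: pose_exp_def \<Theta>_def[symmetric] \<beta>_def[symmetric] R_def[symmetric] matrix_inv_pose[OF R] T pose_eq_iff vec.neg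
         del: transpose_matrix_vector)
qed

subsection \<open>Differentiating the exponential\<close>

lemma bounded_bilinear_matrix_vector_mult: "bounded_bilinear ((*v) :: real^'n^'m \<Rightarrow> real^'n \<Rightarrow> real^'m)"
  unfolding bilinear_conv_bounded_bilinear[symmetric] bilinear_def
  by (auto intro!: linearI simp: matrix_vector_mult_add_rdistrib matrix_vector_right_distrib
      scaleR_matrix_vector_assoc matrix_vector_mult_scaleR)

lemma matrix_mult_add_rdistrib: "(A + B) ** C = A ** C + B ** C" for A B :: "real^'n^'m"
  by (simp add: matrix_matrix_mult_def vec_eq_iff distrib_right sum.distrib)

lemma bounded_bilinear_matrix_matrix_mult: "bounded_bilinear ((**) :: real^'n^'m \<Rightarrow> real^'p^'n \<Rightarrow> real^'p^'m)"
  unfolding bilinear_conv_bounded_bilinear[symmetric] bilinear_def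
  by (auto intro!: linearI simp: matrix_add_ldistrib matrix_mult_add_rdistrib matrix_mult_scaleR_right
      scalar_matrix_assoc)

text \<open>A product rule for a factor c that is merely continuous: since F vanishes at x,
  increments of c only meet terms of first order. It serves at \<Theta> = 0, where the norm is not
  differentiable.\<close>

lemma has_derivative_scaleR_zero:
  fixes F :: "'a::real_normed_vector \<Rightarrow> 'b::real_normed_vector"
  assumes c: "isCont c x" and F: "(F has_derivative F') (at x)" and zero: "F x = 0"
  shows "((\<lambda>y. c y *\<^sub>R F y) has_derivative (\<lambda>v. c x *\<^sub>R F' v)) (at x)"
proof -
  have bl: "bounded_linear F'" using F by (rule has_derivative_bounded_linear)
  obtain K where K: "\<And>v. norm (F' v) \<le> norm v * K" using bounded_linear.bounded[OF bl] by blast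
  have cx: "(c \<longlongrightarrow> c x) (at x)" using c by (simp add: isCont_def)
  have lim: "((\<lambda>y. norm (F y - F' (y - x)) / norm (y - x)) \<longlongrightarrow> 0) (at x)"
    using F zero by (simp add: has_derivative_iff_norm)
  have "((\<lambda>y. \<bar>c y\<bar> * (norm (F y - F' (y - x)) / norm (y - x)) + \<bar>c y - c x\<bar> * K) \<longlongrightarrow> \<bar>c x\<bar> * 0 + \<bar>c x - c x\<bar> * K) (at x)"
    by (intro tendsto_intros lim cx)
  moreover have "norm (norm (c y *\<^sub>R F y - c x *\<^sub>R F' (y - x)) / norm (y - x))
      \<le> \<bar>c y\<bar> * (norm (F y - F' (y - x)) / norm (y - x)) + \<bar>c y - c x\<bar> * K" if "y \<noteq> x" for y
  proof -
    have "c y *\<^sub>R F y - c x *\<^sub>R F' (y - x) = c y *\<^sub>R (F y - F' (y - x)) + (c y - c x) *\<^sub>R F' (y - x)"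
      by (simp add: algebra_simps)
    then have "norm (c y *\<^sub>R F y - c x *\<^sub>R F' (y - x)) \<le> \<bar>c y\<bar> * norm (F y - F' (y - x)) + \<bar>c y - c x\<bar> * norm (F' (y - x))"
      using norm_triangle_ineq[of "c y *\<^sub>R (F y - F' (y - x))" "(c y - c x) *\<^sub>R F' (y - x)"] by simp
    also have "\<dots> \<le> \<bar>c y\<bar> * norm (F y - F' (y - x)) + \<bar>c y - c x\<bar> * (norm (y - x) * K)"
      by (intro add_left_mono mult_left_mono K) simp
    finally show ?thesis using that by (simp add: field_simps)
  qed
  ultimately have "((\<lambda>y. norm (c y *\<^sub>R F y - c x *\<^sub>R F' (y - x)) / norm (y - x)) \<longlongrightarrow> 0) (at x)"
    by (intro Lim_null_comparison[where f = "\<lambda>y. norm (c y *\<^sub>R F y - c x *\<^sub>R F' (y - x)) / norm (y - x)"])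
      (simp_all add: eventually_at_filter)
  then show ?thesis
    using zero bl by (simp add: has_derivative_iff_norm bounded_linear_compose[OF bounded_linear_scaleR_right])
qed

lemma skew_poly_has_derivative:
  assumes "\<Theta> \<noteq> 0" and a: "(a has_real_derivative a') (at (norm \<Theta>))" and b: "(b has_real_derivative b') (at (norm \<Theta>))"
  shows "((\<lambda>x. skew_poly (a (norm x)) (b (norm x)) x) has_derivative
    (\<lambda>v. (a' * (v \<bullet> sgn \<Theta>)) *\<^sub>R skew \<Theta> + a (norm \<Theta>) *\<^sub>R skew v
       + (b' * (v \<bullet> sgn \<Theta>)) *\<^sub>R (skew \<Theta> ** skew \<Theta>) + b (norm \<Theta>) *\<^sub>R (skew v ** skew \<Theta> + skew \<Theta> ** skew v))) (at \<Theta>)"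
proof -
  note n = has_derivative_norm[OF assms(1)]
  have s: "(skew has_derivative skew) (at \<Theta>)"
    by (rule bounded_linear_imp_has_derivative[OF bounded_linear_skew])
  note da = has_derivative_compose[OF n a[unfolded has_field_derivative_def]]
    and db = has_derivative_compose[OF n b[unfolded has_field_derivative_def]]
  note ss = bounded_bilinear.FDERIV[OF bounded_bilinear_matrix_matrix_mult s s]
  note all = has_derivative_add[OF has_derivative_add[OF has_derivative_const has_derivative_scaleR[OF da s]]
      has_derivative_scaleR[OF db ss]]
  show ?thesis unfolding skew_poly_def
    by (rule has_derivative_eq_rhs[OF all]) (simp add: fun_eq_iff add.commute add.left_commute)
qed

text \<open>The values of the coefficients at 0 are multiplied by \<open>skew 0\<close> and may be
  replaced by their limits, after which the product rule for continuous factors applies. The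
  quadratic term has no first-order part.\<close>

lemma skew_poly_has_derivative_0:
  assumes a: "(a \<longlongrightarrow> a0) (at_right 0)" and b: "(b \<longlongrightarrow> b0) (at_right 0)"
  shows "((\<lambda>x. skew_poly (a (norm x)) (b (norm x)) x) has_derivative (\<lambda>v. a0 *\<^sub>R skew v)) (at 0)"
proof -
  have cont: "isCont (\<lambda>x::real^3. if x = 0 then c0 else c (norm x)) 0" if "(c \<longlongrightarrow> c0) (at_right 0)" for c :: "real \<Rightarrow> real" and c0
  proof -
    have "filterlim (norm :: real^3 \<Rightarrow> real) (at_right 0) (at 0)"
      by (simp add: filterlim_at eventually_at_filter tendsto_norm_zero)
    then have "((\<lambda>x::real^3. c (norm x)) \<longlongrightarrow> c0) (at 0)"
      by (rule filterlim_compose[OF that])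
    moreover have "((\<lambda>x::real^3. if x = 0 then c0 else c (norm x)) \<longlongrightarrow> c0) (at 0)
        \<longleftrightarrow> ((\<lambda>x::real^3. c (norm x)) \<longlongrightarrow> c0) (at 0)"
      by (rule filterlim_cong[OF refl refl]) (simp add: eventually_at_filter)
    ultimately show ?thesis by (simp add: isCont_def)
  qed
  have s: "(skew has_derivative skew) (at 0)"
    by (rule bounded_linear_imp_has_derivative[OF bounded_linear_skew])
  have ss: "((\<lambda>x. skew x ** skew x) has_derivative (\<lambda>v. 0)) (at 0)"
    using bounded_bilinear.FDERIV[OF bounded_bilinear_matrix_matrix_mult s s] by (simp add: skew_simps)
  have "((\<lambda>x. mat 1 + (if x = 0 then a0 else a (norm x)) *\<^sub>R skew x + (if x = 0 then b0 else b (norm x)) *\<^sub>R (skew x ** skew x))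
     has_derivative (\<lambda>v. 0 + a0 *\<^sub>R skew v + b0 *\<^sub>R 0)) (at 0)"
  proof (intro has_derivative_add has_derivative_const)
    show "((\<lambda>x. (if x = 0 then a0 else a (norm x)) *\<^sub>R skew x) has_derivative (\<lambda>v. a0 *\<^sub>R skew v)) (at 0)"
      using has_derivative_scaleR_zero[OF cont[OF a] s skew_simps(1)] by simp
    have "skew 0 ** skew 0 = 0" by (simp add: skew_simps)
    from has_derivative_scaleR_zero[OF cont[OF b] ss this]
    show "((\<lambda>x. (if x = 0 then b0 else b (norm x)) *\<^sub>R (skew x ** skew x)) has_derivative (\<lambda>v. b0 *\<^sub>R 0)) (at 0)"
      by simp
  qed
  moreover have "(\<lambda>x. mat 1 + (if x = 0 then a0 else a (norm x)) *\<^sub>R skew x + (if x = 0 then b0 else b (norm x)) *\<^sub>R (skew x ** skew x))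
     = (\<lambda>x. skew_poly (a (norm x)) (b (norm x)) x)"
    by (auto simp: fun_eq_iff skew_poly_def skew_simps)
  ultimately show ?thesis by simp
qed

lemma coef_limits:
  "(coefC \<longlongrightarrow> 1) (at_right 0)" "(coefS \<longlongrightarrow> 1/2) (at_right 0)" "(coefD \<longlongrightarrow> 1/6) (at_right 0)"
  "(coefA \<longlongrightarrow> 1/12) (at_right 0)"
  unfolding coefC_def coefS_def coefD_def coefA_def by real_asymp+

text \<open>Values and derivatives are obtained in one statement so that they share the same \<tau>
  and D.\<close>

lemma coef_derivatives_half_angle:
  assumes "0 < \<theta>" "\<theta> < pi"
  obtains \<tau> D where "D = \<theta>^2 + \<tau>^2" "0 < D"
    "coefC \<theta> = 2 * \<tau> / D" "coefS \<theta> = 2 / D" "coefD \<theta> = (D - 2 * \<tau>) / (\<theta>^2 * D)"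
    "coefA \<theta> = (2 - \<tau>) / (2 * \<theta>^2)"
    "(1 + cos \<theta>) * (\<theta> - sin \<theta>) / (2 * \<theta> * (sin \<theta>)^2) = (D - 2 * \<tau>) / (4 * \<theta>^2)"
    "(1 + cos \<theta>) * (\<theta> + sin \<theta>) / (2 * \<theta>^3 * (sin \<theta>)^2) - 2 / \<theta>^4 = (D + 2 * \<tau> - 8) / (4 * \<theta>^4)"
    "(coefC has_real_derivative (D - 2 * \<theta>^2 - 2 * \<tau>) / (\<theta> * D)) (at \<theta>)"
    "(coefS has_real_derivative (2 * \<tau> - 4) / (\<theta> * D)) (at \<theta>)"
    "(coefD has_real_derivative (2 * \<theta>^2 - 3 * D + 6 * \<tau>) / (\<theta>^3 * D)) (at \<theta>)"
proof -
  obtain \<tau> D where D: "D = \<theta>^2 + \<tau>^2" and D0: "0 < D" and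
    sc: "sin \<theta> = 2 * \<tau> * \<theta> / D" "cos \<theta> = (\<tau>^2 - \<theta>^2) / D" and
    rest: "coefC \<theta> = 2 * \<tau> / D" "coefS \<theta> = 2 / D" "coefD \<theta> = (D - 2 * \<tau>) / (\<theta>^2 * D)"
    "coefA \<theta> = (2 - \<tau>) / (2 * \<theta>^2)"
    "(1 + cos \<theta>) * (\<theta> - sin \<theta>) / (2 * \<theta> * (sin \<theta>)^2) = (D - 2 * \<tau>) / (4 * \<theta>^2)"
    "(1 + cos \<theta>) * (\<theta> + sin \<theta>) / (2 * \<theta>^3 * (sin \<theta>)^2) - 2 / \<theta>^4 = (D + 2 * \<tau> - 8) / (4 * \<theta>^4)"
    using assms by (rule coefficients_half_angle)
  \<comment> \<open>Trading \<tau>^2 for D leaves the sine and cosine at most linear in \<tau>, and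
    the derivative formulas become rational identities without a side relation.\<close>
  have t: "\<tau>^2 = D - \<theta>^2" by (simp add: D)
  have c: "cos \<theta> = 1 - 2 * \<theta>^2 / D" unfolding sc(2) t using D0 by (simp add: field_simps)
  have 1: "(coefC has_real_derivative (D - 2 * \<theta>^2 - 2 * \<tau>) / (\<theta> * D)) (at \<theta>)"
    unfolding coefC_def using assms D0
    by (auto intro!: derivative_eq_intros) (simp add: c sc(1) field_simps eval_nat_numeral)
  have 2: "(coefS has_real_derivative (2 * \<tau> - 4) / (\<theta> * D)) (at \<theta>)"
    unfolding coefS_def using assms D0
    by (auto intro!: derivative_eq_intros) (simp add: c sc(1) field_simps eval_nat_numeral)
  have 3: "(coefD has_real_derivative (2 * \<theta>^2 - 3 * D + 6 * \<tau>) / (\<theta>^3 * D)) (at \<theta>)"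
    unfolding coefD_def using assms D0
    by (auto intro!: derivative_eq_intros) (simp add: c sc(1) field_simps eval_nat_numeral)
  show thesis by (rule that[OF D D0 rest 1 2 3])
qed

text \<open>
  In the next two lemmas denominators are cleared: \<open>V\<close> is \<open>2 N\<close> times \<open>Amat \<Theta> *v w\<close>, \<open>B\<close> is \<open>N D\<close> times
  \<open>Smat \<Theta> *v \<beta>\<close>, and \<open>W\<close> is \<open>4 N\<^sup>2 D\<close> times \<open>Tmat \<Theta> \<beta> *v w\<close>.
\<close>

lemma rotation_kinematics_polynomial:
 fixes \<Theta> x w V :: "real^3" and \<tau> N D :: real
 assumes N: "N = \<Theta> \<bullet> \<Theta>" and D: "D = N + \<tau>^2"
   and V: "V = (2*N) *\<^sub>R w + N *\<^sub>R (\<Theta> \<times> w) + (2-\<tau>) *\<^sub>R (\<Theta> \<times> (\<Theta> \<times> w))"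
 shows "((D - 2*N - 2*\<tau>) * (\<Theta> \<bullet> w)) *\<^sub>R (\<Theta> \<times> x) + \<tau> *\<^sub>R (V \<times> x) + ((2*\<tau>-4) * (\<Theta> \<bullet> w)) *\<^sub>R (\<Theta> \<times> (\<Theta> \<times> x))
    + (V \<times> (\<Theta> \<times> x) + \<Theta> \<times> (V \<times> x))
    = N *\<^sub>R (D *\<^sub>R (w \<times> x) + (2*\<tau>) *\<^sub>R (\<Theta> \<times> (w \<times> x)) + 2 *\<^sub>R (\<Theta> \<times> (\<Theta> \<times> (w \<times> x))))"
  unfolding V D N
  by (simp add: cross3_def vec_eq_iff inner_vec_def sum_3 forall_3) (intro conjI; algebra)

lemma translation_kinematics_polynomial:
 fixes \<Theta> \<beta> w V B W :: "real^3" and \<tau> N D :: real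
 assumes N: "N = \<Theta> \<bullet> \<Theta>" and D: "D = N + \<tau>^2"
   and V: "V = (2*N) *\<^sub>R w + N *\<^sub>R (\<Theta> \<times> w) + (2-\<tau>) *\<^sub>R (\<Theta> \<times> (\<Theta> \<times> w))"
   and B: "B = (N*D) *\<^sub>R \<beta> + (2*N) *\<^sub>R (\<Theta> \<times> \<beta>) + (D-2*\<tau>) *\<^sub>R (\<Theta> \<times> (\<Theta> \<times> \<beta>))"
   and W: "W = B \<times> V + (2*N*D*(2-\<tau>) * (\<beta> \<bullet> w)) *\<^sub>R \<Theta> + (D*(2-\<tau>)*(\<Theta> \<bullet> \<beta>)) *\<^sub>R V
      - ((D-2*\<tau>)*(\<Theta> \<bullet> w)) *\<^sub>R B + (D*(D+2*\<tau>-8)*(\<Theta> \<bullet> \<beta>)*(\<Theta> \<bullet> w)) *\<^sub>R \<Theta>"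
 shows "(2*N*D) *\<^sub>R ((2*N*(2*\<tau>-4)*(\<Theta> \<bullet> w)) *\<^sub>R (\<Theta> \<times> \<beta>) + (2*N) *\<^sub>R (V \<times> \<beta>)
    + (2*(2*N-3*D+6*\<tau>)*(\<Theta> \<bullet> w)) *\<^sub>R (\<Theta> \<times> (\<Theta> \<times> \<beta>)) + (D-2*\<tau>) *\<^sub>R (V \<times> (\<Theta> \<times> \<beta>) + \<Theta> \<times> (V \<times> \<beta>)))
   + ((N*D) *\<^sub>R W + (2*N) *\<^sub>R (\<Theta> \<times> W) + (D-2*\<tau>) *\<^sub>R (\<Theta> \<times> (\<Theta> \<times> W))) = 0"
  unfolding W B V D N
  by (simp add: cross3_def vec_eq_iff inner_vec_def sum_3 forall_3) (intro conjI; algebra)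

section \<open>Kinematic identities for \<open>Amat\<close>, \<open>Smat\<close> and
  \<open>Tmat\<close>\<close>

lemma outer_mult_vec: "outer x y *v w = (y \<bullet> w) *\<^sub>R x"
  by (simp add: outer_def matrix_vector_mult_def inner_vec_def vec_eq_iff sum_distrib_left sum_distrib_right algebra_simps)

lemma Tmat_mult_vec:
  "Tmat \<Theta> \<beta> *v w = (1/2) *\<^sub>R ((Smat \<Theta> *v \<beta>) \<times> (Amat \<Theta> *v w))
    + coefA (norm \<Theta>) *\<^sub>R ((\<beta> \<bullet> w) *\<^sub>R \<Theta> + (\<Theta> \<bullet> \<beta>) *\<^sub>R (Amat \<Theta> *v w))
    - ((1 + cos (norm \<Theta>)) * (norm \<Theta> - sin (norm \<Theta>)) / (2 * norm \<Theta> * (sin (norm \<Theta>))^2) * (\<Theta> \<bullet> w)) *\<^sub>R (Smat \<Theta> *v \<beta>)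
    + (((1 + cos (norm \<Theta>)) * (norm \<Theta> + sin (norm \<Theta>)) / (2 * norm \<Theta> ^ 3 * (sin (norm \<Theta>))^2) - 2 / norm \<Theta> ^ 4)
        * (\<Theta> \<bullet> \<beta>) * (\<Theta> \<bullet> w)) *\<^sub>R \<Theta>"
  by (simp only: Tmat_def Let_def matrix_vector_mult_add_rdistrib matrix_vector_mult_diff_rdistrib
      scaleR_matrix_vector_assoc[symmetric] matrix_vector_mul_assoc[symmetric] outer_mult_vec skew_mult scaleR_scaleR)

lemma inner_skew_poly: "\<Theta> \<bullet> (skew_poly a b \<Theta> *v w) = \<Theta> \<bullet> w"
  by (simp add: skew_poly_mult_vec inner_add_right dot_cross_self)

text \<open>Under \<Theta>' = A w this is the rate of change of the angle: A alters w only by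
  vectors orthogonal to \<Theta>.\<close>

lemma inner_Amat_sgn: "(Amat \<Theta> *v w) \<bullet> sgn \<Theta> = (\<Theta> \<bullet> w) / norm \<Theta>"
proof -
  have "(Amat \<Theta> *v w) \<bullet> sgn \<Theta> = sgn \<Theta> \<bullet> (Amat \<Theta> *v w)" by (rule inner_commute)
  also have "\<dots> = inverse (norm \<Theta>) * (\<Theta> \<bullet> (Amat \<Theta> *v w))" by (simp only: sgn_div_norm inner_scaleR_left)
  also have "\<dots> = (\<Theta> \<bullet> w) / norm \<Theta>" by (simp only: Amat_eq inner_skew_poly divide_inverse mult.commute)
  finally show ?thesis .
qed

lemma scaleR_factor_two_N:
  "N \<noteq> 0 \<Longrightarrow> w + (1/2) *\<^sub>R X + ((2-\<tau>)/(2*N)) *\<^sub>R Y = (1/(2*N)) *\<^sub>R ((2*N) *\<^sub>R w + N *\<^sub>R X + (2-\<tau>) *\<^sub>R Y)"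
  for w X Y :: "'a::real_vector"
  by (simp add: scaleR_add_right)

lemma scaleR_factor_N_D:
  "N \<noteq> 0 \<Longrightarrow> D \<noteq> 0 \<Longrightarrow> w + (2/D) *\<^sub>R X + ((D-2*\<tau>)/(N*D)) *\<^sub>R Y = (1/(N*D)) *\<^sub>R ((N*D) *\<^sub>R w + (2*N) *\<^sub>R X + (D-2*\<tau>) *\<^sub>R Y)"
  for w X Y :: "'a::real_vector"
  by (simp add: scaleR_add_right)

text \<open>The last two identities are the rotational and the translational kinematics. In the
  translation \<open>Smat \<Theta> *v \<beta>\<close>, the change of \<open>Smat \<Theta>\<close>
  caused by w must be compensated by a change of \<beta>, and \<open>Tmat\<close> is the matrix that
  achieves this. Away from 0, clearing denominators leaves the two polynomial identities.\<close>

lemma rotation_kinematics: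
  assumes "norm \<Theta> < pi"
  obtains dR dS where "(rodrigues has_derivative dR) (at \<Theta>)" "(Smat has_derivative dS) (at \<Theta>)"
    "\<And>w. dR (Amat \<Theta> *v w) = rodrigues \<Theta> ** skew w"
    "\<And>w \<beta>. dS (Amat \<Theta> *v w) *v \<beta> + Smat \<Theta> *v (Tmat \<Theta> \<beta> *v w) = 0"
proof (cases "\<Theta> = 0")
  case True
  show thesis
  proof (rule that)
    show "(rodrigues has_derivative (\<lambda>v. 1 *\<^sub>R skew v)) (at \<Theta>)"
      unfolding True rodrigues_def[abs_def] by (rule skew_poly_has_derivative_0 coef_limits)+
    show "(Smat has_derivative (\<lambda>v. (1/2) *\<^sub>R skew v)) (at \<Theta>)"
      unfolding True Smat_eq[abs_def] by (rule skew_poly_has_derivative_0 coef_limits)+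
    show "1 *\<^sub>R skew (Amat \<Theta> *v w) = rodrigues \<Theta> ** skew w" for w
      by (simp add: True Amat_eq rodrigues_def)
    show "((1/2) *\<^sub>R skew (Amat \<Theta> *v w)) *v \<beta> + Smat \<Theta> *v (Tmat \<Theta> \<beta> *v w) = 0" for w \<beta>
      unfolding Tmat_mult_vec using cross_skew[of \<beta> w]
      by (simp add: True Amat_eq Smat_eq scaleR_matrix_vector_assoc[symmetric])
  qed
next
  case False
  define \<theta> N where "\<theta> = norm \<Theta>" and "N = \<Theta> \<bullet> \<Theta>"
  have \<theta>: "0 < \<theta>" "\<theta> < pi" using False assms by (simp_all add: \<theta>_def)
  have N: "N = \<theta>^2" "N \<noteq> 0" using False by (simp_all add: \<theta>_def N_def power2_norm_eq_inner)
  obtain \<tau> D where DD: "D = \<theta>^2 + \<tau>^2" and D: "0 < D" and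
    c: "coefC \<theta> = 2 * \<tau> / D" "coefS \<theta> = 2 / D" "coefD \<theta> = (D - 2 * \<tau>) / (\<theta>^2 * D)"
    "coefA \<theta> = (2 - \<tau>) / (2 * \<theta>^2)" and
    c2: "(1 + cos \<theta>) * (\<theta> - sin \<theta>) / (2 * \<theta> * (sin \<theta>)^2) = (D - 2 * \<tau>) / (4 * \<theta>^2)" and
    c3: "(1 + cos \<theta>) * (\<theta> + sin \<theta>) / (2 * \<theta>^3 * (sin \<theta>)^2) - 2 / \<theta>^4 = (D + 2 * \<tau> - 8) / (4 * \<theta>^4)" and
    d: "(coefC has_real_derivative (D - 2 * \<theta>^2 - 2 * \<tau>) / (\<theta> * D)) (at \<theta>)"
    "(coefS has_real_derivative (2 * \<tau> - 4) / (\<theta> * D)) (at \<theta>)"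
    "(coefD has_real_derivative (2 * \<theta>^2 - 3 * D + 6 * \<tau>) / (\<theta>^3 * D)) (at \<theta>)"
    using \<theta> by (rule coef_derivatives_half_angle)
  have DN: "D = N + \<tau>^2" by (simp add: DD N)
  have cN: "coefC \<theta> = 2 * \<tau> / D" "coefS \<theta> = 2 / D" "coefD \<theta> = (D - 2 * \<tau>) / (N * D)"
    "coefA \<theta> = (2 - \<tau>) / (2 * N)"
    by (simp_all only: c N(1))
  have \<theta>4: "\<theta>^4 = N^2" by (simp add: N)
  define V where "V w = (2*N) *\<^sub>R w + N *\<^sub>R (\<Theta> \<times> w) + (2-\<tau>) *\<^sub>R (\<Theta> \<times> (\<Theta> \<times> w))" for w
  have Av: "Amat \<Theta> *v w = (1 / (2 * N)) *\<^sub>R V w" for w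
    unfolding Amat_eq skew_poly_mult_vec V_def \<theta>_def[symmetric] cN
    by (rule scaleR_factor_two_N[OF N(2)])
  have p: "(Amat \<Theta> *v w) \<bullet> sgn \<Theta> = (\<Theta> \<bullet> w) / \<theta>" for w
    by (simp only: inner_Amat_sgn \<theta>_def)
  define dR where "dR v = ((D - 2 * \<theta>^2 - 2 * \<tau>) / (\<theta> * D) * (v \<bullet> sgn \<Theta>)) *\<^sub>R skew \<Theta> + coefC \<theta> *\<^sub>R skew v
       + ((2 * \<tau> - 4) / (\<theta> * D) * (v \<bullet> sgn \<Theta>)) *\<^sub>R (skew \<Theta> ** skew \<Theta>) + coefS \<theta> *\<^sub>R (skew v ** skew \<Theta> + skew \<Theta> ** skew v)" for v
  define dS where "dS v = ((2 * \<tau> - 4) / (\<theta> * D) * (v \<bullet> sgn \<Theta>)) *\<^sub>R skew \<Theta> + coefS \<theta> *\<^sub>R skew v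
       + ((2 * \<theta>^2 - 3 * D + 6 * \<tau>) / (\<theta>^3 * D) * (v \<bullet> sgn \<Theta>)) *\<^sub>R (skew \<Theta> ** skew \<Theta>) + coefD \<theta> *\<^sub>R (skew v ** skew \<Theta> + skew \<Theta> ** skew v)" for v
  have dRx: "dR (Amat \<Theta> *v w) *v x = ((D - 2 * N - 2 * \<tau>) / (N * D) * (\<Theta> \<bullet> w)) *\<^sub>R (\<Theta> \<times> x)
      + (\<tau> / (N * D)) *\<^sub>R (V w \<times> x) + ((2 * \<tau> - 4) / (N * D) * (\<Theta> \<bullet> w)) *\<^sub>R (\<Theta> \<times> (\<Theta> \<times> x))
      + (1 / (N * D)) *\<^sub>R (V w \<times> (\<Theta> \<times> x) + \<Theta> \<times> (V w \<times> x))" for w x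
    unfolding dR_def p unfolding Av using \<theta> D
    by (simp add: matrix_vector_mult_add_rdistrib scaleR_matrix_vector_assoc[symmetric] matrix_vector_mul_assoc[symmetric]
       cross_mult_left cross_mult_right c N scaleR_add_right power2_eq_square mult_ac)
  have dSx: "dS (Amat \<Theta> *v w) *v x = ((2 * \<tau> - 4) / (N * D) * (\<Theta> \<bullet> w)) *\<^sub>R (\<Theta> \<times> x)
      + (1 / (N * D)) *\<^sub>R (V w \<times> x) + ((2 * N - 3 * D + 6 * \<tau>) / (N^2 * D) * (\<Theta> \<bullet> w)) *\<^sub>R (\<Theta> \<times> (\<Theta> \<times> x))
      + ((D - 2 * \<tau>) / (2 * N^2 * D)) *\<^sub>R (V w \<times> (\<Theta> \<times> x) + \<Theta> \<times> (V w \<times> x))" for w x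
    unfolding dS_def p unfolding Av using \<theta> D
    by (simp add: matrix_vector_mult_add_rdistrib scaleR_matrix_vector_assoc[symmetric] matrix_vector_mul_assoc[symmetric]
       cross_mult_left cross_mult_right c N scaleR_add_right power2_eq_square power3_eq_cube mult_ac)
  define B where "B \<beta> = (N*D) *\<^sub>R \<beta> + (2*N) *\<^sub>R (\<Theta> \<times> \<beta>) + (D-2*\<tau>) *\<^sub>R (\<Theta> \<times> (\<Theta> \<times> \<beta>))" for \<beta>
  have Sv: "Smat \<Theta> *v \<beta> = (1 / (N * D)) *\<^sub>R B \<beta>" for \<beta>
    unfolding Smat_eq skew_poly_mult_vec B_def \<theta>_def[symmetric] cN
    using N(2) D by (intro scaleR_factor_N_D) auto
  define W where "W \<beta> w = B \<beta> \<times> V w + (2*N*D*(2-\<tau>) * (\<beta> \<bullet> w)) *\<^sub>R \<Theta> + (D*(2-\<tau>)*(\<Theta> \<bullet> \<beta>)) *\<^sub>R V w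
      - ((D-2*\<tau>)*(\<Theta> \<bullet> w)) *\<^sub>R B \<beta> + (D*(D+2*\<tau>-8)*(\<Theta> \<bullet> \<beta>)*(\<Theta> \<bullet> w)) *\<^sub>R \<Theta>" for \<beta> w
  have Tv: "Tmat \<Theta> \<beta> *v w = (1 / (4 * N^2 * D)) *\<^sub>R W \<beta> w" for \<beta> w
    unfolding Tmat_mult_vec \<theta>_def[symmetric] c2 c3 unfolding Av Sv cN(4) W_def N(1)[symmetric] \<theta>4 using N(2) D
    by (simp add: cross_mult_left cross_mult_right scaleR_add_right scaleR_diff_right
       power2_eq_square mult_ac) (simp add: field_simps)
  show thesis
  proof (rule that)
    show "(rodrigues has_derivative dR) (at \<Theta>)"
      unfolding rodrigues_def[abs_def] dR_def[abs_def]
      using skew_poly_has_derivative[OF False d(1,2)[unfolded \<theta>_def]] by (simp add: \<theta>_def)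
    show "(Smat has_derivative dS) (at \<Theta>)"
      unfolding Smat_eq[abs_def] dS_def[abs_def]
      using skew_poly_has_derivative[OF False d(2,3)[unfolded \<theta>_def]] by (simp add: \<theta>_def)
    show "dR (Amat \<Theta> *v w) = rodrigues \<Theta> ** skew w" for w
    proof (subst matrix_eq, rule allI)
      fix x
      note poly = rotation_kinematics_polynomial[OF N_def DN V_def, of w x]
      have "dR (Amat \<Theta> *v w) *v x = (1 / (N * D)) *\<^sub>R (((D - 2*N - 2*\<tau>) * (\<Theta> \<bullet> w)) *\<^sub>R (\<Theta> \<times> x) + \<tau> *\<^sub>R (V w \<times> x)
        + ((2*\<tau>-4) * (\<Theta> \<bullet> w)) *\<^sub>R (\<Theta> \<times> (\<Theta> \<times> x)) + (V w \<times> (\<Theta> \<times> x) + \<Theta> \<times> (V w \<times> x)))"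
        unfolding dRx by (simp add: scaleR_add_right)
      also have "\<dots> = rodrigues \<Theta> *v (w \<times> x)"
        unfolding poly rodrigues_def \<theta>_def[symmetric] using N(2) D
        by (simp add: skew_poly_mult_vec c scaleR_add_right)
      finally show "dR (Amat \<Theta> *v w) *v x = (rodrigues \<Theta> ** skew w) *v x"
        by (simp add: matrix_vector_mul_assoc[symmetric])
    qed
    show "dS (Amat \<Theta> *v w) *v \<beta> + Smat \<Theta> *v (Tmat \<Theta> \<beta> *v w) = 0" for w \<beta>
    proof -
      note poly = translation_kinematics_polynomial[OF N_def DN V_def B_def W_def, of w \<beta>]
      \<comment> \<open>The denominator is N D from \<open>Smat\<close> times 4 N^2 D from
        \<open>Tmat\<close>.\<close>
      have "Smat \<Theta> *v (Tmat \<Theta> \<beta> *v w) = (1 / (4 * N^3 * D^2)) *\<^sub>R B (W \<beta> w)"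
        unfolding Tv Sv[of "_ *\<^sub>R _"] B_def[of "_ *\<^sub>R _"] by (simp add: B_def[of "W \<beta> w"] cross_mult_right scaleR_add_right power2_eq_square power3_eq_cube mult_ac)
      moreover have "dS (Amat \<Theta> *v w) *v \<beta> = (1 / (4 * N^3 * D^2)) *\<^sub>R
         ((2*N*D) *\<^sub>R ((2*N*(2*\<tau>-4)*(\<Theta> \<bullet> w)) *\<^sub>R (\<Theta> \<times> \<beta>) + (2*N) *\<^sub>R (V w \<times> \<beta>)
    + (2*(2*N-3*D+6*\<tau>)*(\<Theta> \<bullet> w)) *\<^sub>R (\<Theta> \<times> (\<Theta> \<times> \<beta>)) + (D-2*\<tau>) *\<^sub>R (V w \<times> (\<Theta> \<times> \<beta>) + \<Theta> \<times> (V w \<times> \<beta>))))"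
        unfolding dSx using N(2) D
        by (simp add: scaleR_add_right power2_eq_square power3_eq_cube mult_ac)
          (intro arg_cong2[where f = "(+)"] arg_cong2[where f = scaleR] refl; simp add: field_simps)
      ultimately show ?thesis using poly unfolding B_def[of "W \<beta> w"]
        by (simp only: scaleR_add_right[symmetric]) simp
    qed
  qed
qed

lemma pose_exp_has_derivative:
  assumes "norm (rotv \<eta>) < pi"
  obtains E' where "(pose_exp has_derivative E') (at \<eta>)"
    "\<And>\<zeta>. E' (Gmat \<eta> *v \<zeta>) = pose_exp \<eta> ** vee \<zeta>"
proof -
  define \<Theta> \<beta> where "\<Theta> = rotv \<eta>" and "\<beta> = transv \<eta>"
  have n: "norm \<Theta> < pi" using assms by (simp add: \<Theta>_def)
  obtain dR dS where dR: "(rodrigues has_derivative dR) (at \<Theta>)" and dS: "(Smat has_derivative dS) (at \<Theta>)"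
    and R: "\<And>w. dR (Amat \<Theta> *v w) = rodrigues \<Theta> ** skew w"
    and S: "\<And>w \<beta>. dS (Amat \<Theta> *v w) *v \<beta> + Smat \<Theta> *v (Tmat \<Theta> \<beta> *v w) = 0"
    using rotation_kinematics[OF n] by metis
  \<comment> \<open>The left Jacobian is the rotation times the right one, which
    \<open>Amat \<Theta>\<close> inverts. This yields the part of the derivative of the translation
    that stems from \<open>transv \<zeta>\<close>.\<close>
  have SA: "Smat \<Theta> *v (Amat \<Theta> *v x) = rodrigues \<Theta> *v x" for x
  proof -
    have "Smat \<Theta> ** Amat \<Theta> = rodrigues \<Theta> ** (Smat (- \<Theta>) ** Amat (- (- \<Theta>)))"
      by (simp add: matrix_mul_assoc rodrigues_Smat_uminus[OF n])
    then show ?thesis using Smat_Amat_uminus(1)[of "- \<Theta>"] n by (simp add: matrix_vector_mul_assoc)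
  qed
  have r: "(rotv has_derivative rotv) (at \<eta>)" and t: "(transv has_derivative transv) (at \<eta>)"
    by (rule bounded_linear_imp_has_derivative[OF bounded_linear_rotv]
        bounded_linear_imp_has_derivative[OF bounded_linear_transv])+
  define L where "L z = (blockmat (fst z) (columnvector (snd z)) 0 0 :: real^(3 + 1)^(3 + 1))" for z :: "(real^3^3) \<times> (real^3)"
  have "bounded_linear L"
    by (auto intro!: linear_conv_bounded_linear[THEN iffD1] linearI
        simp: L_def blockmat_add blockmat_scaleR columnvector_simps)
  note L = bounded_linear.has_derivative[OF this]
  have eq: "pose_exp x = L (rodrigues (rotv x), Smat (rotv x) *v transv x) + blockmat 0 0 0 (mat 1)" for x
    by (simp add: pose_exp_def pose_def L_def blockmat_add)
  define E' where "E' v = L (dR (rotv v), Smat \<Theta> *v transv v + dS (rotv v) *v \<beta>)" for v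
  show thesis
  proof (rule that)
    have "((\<lambda>x. (rodrigues (rotv x), Smat (rotv x) *v transv x)) has_derivative
        (\<lambda>v. (dR (rotv v), Smat \<Theta> *v transv v + dS (rotv v) *v \<beta>))) (at \<eta>)"
      using bounded_bilinear.FDERIV[OF bounded_bilinear_matrix_vector_mult
          has_derivative_compose[OF r dS[unfolded \<Theta>_def]] t]
        has_derivative_compose[OF r dR[unfolded \<Theta>_def]]
      by (auto intro!: has_derivative_Pair simp: \<Theta>_def \<beta>_def)
    from has_derivative_add[OF L[OF this] has_derivative_const[of "blockmat 0 0 0 (mat 1)"]]
    show "(pose_exp has_derivative E') (at \<eta>)"
      unfolding eq[abs_def] E'_def[abs_def] by simp
    show "E' (Gmat \<eta> *v \<zeta>) = pose_exp \<eta> ** vee \<zeta>" for \<zeta>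
      using S[of "rotv \<zeta>" \<beta>]
      by (simp add: E'_def L_def Gmat_def rotv_blockmat transv_blockmat \<Theta>_def[symmetric] \<beta>_def[symmetric]
          R pose_exp_def pose_mult_vee matrix_vector_right_distrib SA add_ac)
  qed
qed

text \<open>The matrix is block lower triangular with invertible diagonal blocks, so the system is
  solved by forward substitution.\<close>

lemma Gmat_surj:
  assumes "norm (rotv \<eta>) < pi"
  obtains \<zeta> where "Gmat \<eta> *v \<zeta> = v"
proof
  define \<Theta> \<beta> where "\<Theta> = rotv \<eta>" and "\<beta> = transv \<eta>"
  define w where "w = Smat (- \<Theta>) *v rotv v"
  have A: "Amat \<Theta> *v (Smat (- \<Theta>) *v x) = x" for x
    using Smat_Amat_uminus(2)[of "- \<Theta>"] assms by (simp add: matrix_vector_mul_assoc \<Theta>_def)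
  show "Gmat \<eta> *v vec6 w (Smat (- \<Theta>) *v (transv v - Tmat \<Theta> \<beta> *v w)) = v"
    by (rule vec6_eqI) (simp_all add: Gmat_def rotv_blockmat transv_blockmat \<Theta>_def[symmetric] \<beta>_def[symmetric] A w_def)
qed

text \<open>Bookkeeping for \<open>Tmat_axis\<close>, where every term is a combination of \<Theta>
  \<times> \<beta>, \<beta> and \<Theta>.\<close>

lemma scaleR_collect_three:
  fixes X \<beta> \<Theta> :: "'a::real_vector"
  shows "h *\<^sub>R (- a *\<^sub>R X + b *\<^sub>R \<beta> - c *\<^sub>R \<Theta>) + d *\<^sub>R (q *\<^sub>R \<Theta> + q *\<^sub>R \<Theta>)
     - (e * n) *\<^sub>R (f *\<^sub>R \<beta> + g *\<^sub>R X + k *\<^sub>R \<Theta>) + (l * q * n) *\<^sub>R \<Theta> + (r *\<^sub>R \<beta> + s *\<^sub>R X + t *\<^sub>R \<Theta>)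
   = (h * (- a) - e * n * g + s) *\<^sub>R X + (h * b - e * n * f + r) *\<^sub>R \<beta>
     + (- (h * c) + d * (q + q) - e * n * k + l * q * n + t) *\<^sub>R \<Theta>"
  by (simp add: algebra_simps) (simp add: scaleR_add_left[symmetric])

text \<open>The translational block of \<open>Gmat \<eta> *v \<eta> = \<eta>\<close>, which
  expresses that the one-parameter subgroup generated by \<open>vee \<eta>\<close> has body velocity
  \<eta>. By the Lagrange formula all terms lie in the span of \<Theta>, \<beta> and \<Theta>
  \<times> \<beta>, and the three coefficients are compared in the half-angle variables.\<close>

lemma Tmat_axis:
  assumes "norm \<Theta> < pi"
  shows "Tmat \<Theta> \<beta> *v \<Theta> + Amat \<Theta> *v \<beta> = \<beta>"
proof (cases "\<Theta> = 0")
  case True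
  then show ?thesis by (simp add: Tmat_mult_vec Amat_eq)
next
  case False
  define \<theta> q X where "\<theta> = norm \<Theta>" and "q = \<Theta> \<bullet> \<beta>" and "X = \<Theta> \<times> \<beta>"
  have \<theta>: "0 < \<theta>" "\<theta> < pi" using False assms by (simp_all add: \<theta>_def)
  have N: "\<Theta> \<bullet> \<Theta> = \<theta>^2" by (simp add: \<theta>_def power2_norm_eq_inner)
  have q': "\<beta> \<bullet> \<Theta> = q" by (simp add: q_def inner_commute)
  obtain \<tau> D where "D = \<theta>^2 + \<tau>^2" and D: "0 < D" and
    c: "coefS \<theta> = 2 / D" "coefD \<theta> = (D - 2 * \<tau>) / (\<theta>^2 * D)"
    "coefA \<theta> = (2 - \<tau>) / (2 * \<theta>^2)" and
    c2: "(1 + cos \<theta>) * (\<theta> - sin \<theta>) / (2 * \<theta> * (sin \<theta>)^2) = (D - 2 * \<tau>) / (4 * \<theta>^2)" and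
    c3: "(1 + cos \<theta>) * (\<theta> + sin \<theta>) / (2 * \<theta>^3 * (sin \<theta>)^2) - 2 / \<theta>^4 = (D + 2 * \<tau> - 8) / (4 * \<theta>^4)"
    using \<theta> by (rule coefficients_half_angle)
  have XX: "\<Theta> \<times> X = q *\<^sub>R \<Theta> - (\<theta>^2) *\<^sub>R \<beta>"
    unfolding X_def q_def N[symmetric] by (rule Lagrange)
  have X\<Theta>: "X \<times> \<Theta> = (\<theta>^2) *\<^sub>R \<beta> - q *\<^sub>R \<Theta>" unfolding cross_skew[of X] XX by simp
  have \<beta>\<Theta>: "\<beta> \<times> \<Theta> = - X" unfolding X_def by (rule cross_skew)
  have S: "Smat \<Theta> *v \<beta> = (1 - (D - 2 * \<tau>) / D) *\<^sub>R \<beta> + (2 / D) *\<^sub>R X + ((D - 2 * \<tau>) * q / (\<theta>^2 * D)) *\<^sub>R \<Theta>"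
    unfolding Smat_eq skew_poly_mult_vec \<theta>_def[symmetric] c X_def[symmetric] XX using \<theta>
    by (simp add: scaleR_diff_right scaleR_diff_left)
  have A: "Amat \<Theta> *v \<beta> = (\<tau> / 2) *\<^sub>R \<beta> + (1/2) *\<^sub>R X + ((2 - \<tau>) * q / (2 * \<theta>^2)) *\<^sub>R \<Theta>"
  proof -
    have "(2 - \<tau>) / (2 * \<theta>^2) * \<theta>^2 = 1 - \<tau> / 2" using \<theta> by (simp add: field_simps)
    then have "((2 - \<tau>) / (2 * \<theta>^2)) *\<^sub>R (q *\<^sub>R \<Theta> - (\<theta>^2) *\<^sub>R \<beta>) = ((2 - \<tau>) * q / (2 * \<theta>^2)) *\<^sub>R \<Theta> - (1 - \<tau> / 2) *\<^sub>R \<beta>"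
      by (simp only: scaleR_diff_right scaleR_scaleR times_divide_eq_left)
    then show ?thesis
      unfolding Amat_eq skew_poly_mult_vec \<theta>_def[symmetric] c X_def[symmetric] XX
      by (simp add: scaleR_diff_left)
  qed
  have A\<Theta>: "Amat \<Theta> *v \<Theta> = \<Theta>" by (simp add: Amat_eq skew_poly_fixes_axis)
  have S\<Theta>: "(Smat \<Theta> *v \<beta>) \<times> \<Theta> = - ((2 * \<tau>) / D) *\<^sub>R X + (2 / D * \<theta>^2) *\<^sub>R \<beta> - (2 / D * q) *\<^sub>R \<Theta>"
  proof -
    have "1 - (D - 2 * \<tau>) / D = 2 * \<tau> / D" using D by (simp add: field_simps)
    then show ?thesis
      unfolding S by (simp add: cross_add_left cross_mult_left X\<Theta> \<beta>\<Theta> scaleR_diff_right)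
  qed
  have "Tmat \<Theta> \<beta> *v \<Theta> + Amat \<Theta> *v \<beta> =
     (1/2 * (- ((2 * \<tau>) / D)) - (D - 2 * \<tau>) / (4 * \<theta>^2) * \<theta>^2 * (2 / D) + 1/2) *\<^sub>R X
   + (1/2 * (2 / D * \<theta>^2) - (D - 2 * \<tau>) / (4 * \<theta>^2) * \<theta>^2 * (1 - (D - 2 * \<tau>) / D) + \<tau> / 2) *\<^sub>R \<beta>
   + (- (1/2 * (2 / D * q)) + (2 - \<tau>) / (2 * \<theta>^2) * (q + q)
      - (D - 2 * \<tau>) / (4 * \<theta>^2) * \<theta>^2 * ((D - 2 * \<tau>) * q / (\<theta>^2 * D))
      + (D + 2 * \<tau> - 8) / (4 * \<theta>^4) * q * \<theta>^2 + (2 - \<tau>) * q / (2 * \<theta>^2)) *\<^sub>R \<Theta>"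
    unfolding Tmat_mult_vec A\<Theta> S\<Theta> A q' q_def[symmetric] N \<theta>_def[symmetric] c2 c3 c(3) unfolding S
    by (rule scaleR_collect_three)
  also have "1/2 * (- ((2 * \<tau>) / D)) - (D - 2 * \<tau>) / (4 * \<theta>^2) * \<theta>^2 * (2 / D) + 1/2 = 0"
    using \<theta> D by (simp add: field_simps)
  also have "1/2 * (2 / D * \<theta>^2) - (D - 2 * \<tau>) / (4 * \<theta>^2) * \<theta>^2 * (1 - (D - 2 * \<tau>) / D) + \<tau> / 2 = 1"
    using \<theta> D by (simp add: field_simps) (simp add: \<open>D = _\<close> algebra_simps power2_eq_square power4_eq_xxxx)
  also have "- (1/2 * (2 / D * q)) + (2 - \<tau>) / (2 * \<theta>^2) * (q + q)
      - (D - 2 * \<tau>) / (4 * \<theta>^2) * \<theta>^2 * ((D - 2 * \<tau>) * q / (\<theta>^2 * D))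
      + (D + 2 * \<tau> - 8) / (4 * \<theta>^4) * q * \<theta>^2 + (2 - \<tau>) * q / (2 * \<theta>^2) = 0"
    using \<theta> D by (simp add: field_simps eval_nat_numeral) (simp add: \<open>D = _\<close> algebra_simps power2_eq_square)
  finally show ?thesis by simp
qed

lemma Gmat_fixes: "norm (rotv \<eta>) < pi \<Longrightarrow> Gmat \<eta> *v \<eta> = \<eta>"
  by (rule vec6_eqI) (simp_all add: Gmat_def rotv_blockmat transv_blockmat Tmat_axis, simp add: Amat_eq skew_poly_fixes_axis)

lemma Gmat_0: "Gmat 0 *v v = v"
  by (rule vec6_eqI) (simp_all add: Gmat_def rotv_blockmat transv_blockmat Amat_eq Tmat_mult_vec)

subsection \<open>Continuity of the logarithm\<close>

lemma bounded_trace_rotation_matrix: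
  fixes R :: "real^3^3"
  assumes "rotation_matrix R"
  shows "-1 \<le> (trace R - 1) / 2" "(trace R - 1) / 2 \<le> 1"
proof -
  have "((trace R - 1) / 2)\<^sup>2 \<le> 1" using norm_axial[OF assms] by (metis diff_ge_0_iff_ge zero_le_power2)
  then show "-1 \<le> (trace R - 1) / 2" "(trace R - 1) / 2 \<le> 1"
    using abs_square_le_1[of "(trace R - 1) / 2"] by auto
qed

lemma isCont_divide_sin:
  assumes "0 \<le> x" "x < pi"
  shows "isCont (\<lambda>x::real. if x = 0 then 1 else x / sin x) x"
proof (cases "x = 0")
  case True
  have "((\<lambda>x::real. x / sin x) \<longlongrightarrow> 1) (at_right 0)" "((\<lambda>x::real. x / sin x) \<longlongrightarrow> 1) (at_left 0)"
    by real_asymp+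
  then have "((\<lambda>x::real. x / sin x) \<longlongrightarrow> 1) (at 0)" by (simp add: filterlim_at_split)
  then have "((\<lambda>x::real. if x = 0 then 1 else x / sin x) \<longlongrightarrow> 1) (at 0)"
    by (rule filterlim_cong[THEN iffD1, rotated -1, OF _ refl refl]) (simp add: eventually_at_filter)
  then show ?thesis using True by (simp add: isCont_def)
next
  case False
  then have "sin x \<noteq> 0" using assms sin_gt_zero[of x] by simp
  then have "isCont (\<lambda>x. x / sin x) x" by (intro continuous_intros)
  moreover have "eventually (\<lambda>y. y \<noteq> 0) (nhds x)" using False by (rule t1_space_nhds)
  ultimately show ?thesis
    by (subst isCont_cong[where g = "\<lambda>x. x / sin x"]) (auto elim: eventually_mono)
qed

lemma isCont_Amat:
  assumes "norm \<Theta> < pi"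
  shows "isCont Amat \<Theta>"
proof (cases "\<Theta> = 0")
  case True
  show ?thesis
    unfolding True Amat_eq[abs_def]
    by (rule has_derivative_continuous, rule skew_poly_has_derivative_0) (rule tendsto_const coef_limits)+
next
  case False
  then have s: "sin (norm \<Theta>) \<noteq> 0" using assms sin_gt_zero[of "norm \<Theta>"] by simp
  have k: "isCont skew \<Theta>" by (rule linear_continuous_at[OF bounded_linear_skew])
  show ?thesis
    unfolding Amat_eq[abs_def] skew_poly_def coefA_def
    by (intro continuous_intros k bounded_bilinear.continuous[OF bounded_bilinear_matrix_matrix_mult])
       (use False s in auto)
qed

lemma bounded_linear_axial: "bounded_linear axial"
  by (auto intro!: linear_conv_bounded_linear[THEN iffD1] linearI
      simp: axial_def vec_eq_iff forall_3 algebra_simps diff_divide_distrib add_divide_distrib)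

text \<open>Formulated for curves in \<open>SE3\<close>, because membership keeps the normalised
  trace in the interval from -1 to 1, on which arccos is continuous.\<close>

lemma continuous_pose_log:
  fixes h :: "real \<Rightarrow> real^(3 + 1)^(3 + 1)"
  assumes h: "continuous (at t within S) h" and "t \<in> S"
    and SE3: "\<And>s. s \<in> S \<Longrightarrow> h s \<in> SE3" and angle: "principal_angle (rotm (h t)) < pi"
  shows "continuous (at t within S) (\<lambda>s. pose_log (h s))"
proof -
  have R: "continuous (at t within S) (\<lambda>s. rotm (h s))" and b: "continuous (at t within S) (\<lambda>s. posv (h s))"
    using bounded_linear.continuous[OF bounded_linear_rotm h] bounded_linear.continuous[OF bounded_linear_posv h] by auto
  have rot: "rotation_matrix (rotm (h s))" if "s \<in> S" for s using SE3[OF that] by (simp add: SE3_iff)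
  have entry: "continuous (at t within S) (\<lambda>s. rotm (h s) $ i $ j)" for i j
    using R by (intro continuous_component)
  have "continuous (at t within S) (\<lambda>s. (trace (rotm (h s)) - 1) / 2)"
    unfolding trace_def by (intro continuous_intros entry) simp
  then have "((\<lambda>s. (trace (rotm (h s)) - 1) / 2) \<longlongrightarrow> (trace (rotm (h t)) - 1) / 2) (at t within S)"
    by (simp add: continuous_within)
  then have "((\<lambda>s. arccos ((trace (rotm (h s)) - 1) / 2)) \<longlongrightarrow> arccos ((trace (rotm (h t)) - 1) / 2)) (at t within S)"
    using bounded_trace_rotation_matrix[OF rot] \<open>t \<in> S\<close>
    by (intro continuous_on_tendsto_compose[OF continuous_on_arccos']) (auto simp: eventually_at_filter)
  then have \<theta>: "continuous (at t within S) (\<lambda>s. principal_angle (rotm (h s)))"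
    by (simp add: continuous_within principal_angle_def)
  have pos: "0 \<le> principal_angle (rotm (h t))"
    unfolding principal_angle_def using bounded_trace_rotation_matrix[OF rot[OF \<open>t \<in> S\<close>]] by (intro arccos_lbound)
  have axial: "continuous (at t within S) (\<lambda>s. axial (rotm (h s)))"
    by (rule bounded_linear.continuous[OF bounded_linear_axial R])
  have log: "continuous (at t within S) (\<lambda>s. rotlog (rotm (h s)))"
    unfolding rotlog_def Let_def
    by (intro continuous_scaleR axial continuous_within_compose3[OF isCont_divide_sin[OF pos angle] \<theta>])
  have "continuous (at t within S) (\<lambda>s. Amat (- rotlog (rotm (h s))))"
    by (rule continuous_within_compose3[OF isCont_Amat continuous_minus[OF log]])
       (use rodrigues_rotlog(2)[OF rot[OF \<open>t \<in> S\<close>] angle] angle in simp)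
  from bounded_bilinear.continuous[OF bounded_bilinear_matrix_vector_mult this b]
  have "continuous (at t within S) (\<lambda>s. Amat (- rotlog (rotm (h s))) *v posv (h s))" .
  from bounded_linear.continuous[OF bounded_linear_vec6 continuous_Pair[OF log this]]
  show ?thesis by (simp add: pose_log_def)
qed

subsection \<open>Kinematics in exponential coordinates\<close>

text \<open>An inverse function theorem along a curve, for maps whose image need not be open.
  Injectivity gives E a left inverse L, and the increment \<Delta> of \<eta> equals L F - L (F - E
  \<Delta>), where F is the increment of f along \<eta>. Continuity of \<eta> makes the second term
  at most half of \<Delta>, so \<Delta> is of order s - t; the error is then of smaller
  order.\<close>

lemma has_vector_derivative_inverse:
  fixes f :: "'a::euclidean_space \<Rightarrow> 'b::euclidean_space" and \<eta> :: "real \<Rightarrow> 'a"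
  assumes f: "(f has_derivative E) (at (\<eta> t))" and inj: "inj E"
    and cont: "continuous (at t within S) \<eta>"
    and deriv: "((\<lambda>s. f (\<eta> s)) has_vector_derivative E v) (at t within S)"
  shows "(\<eta> has_vector_derivative v) (at t within S)"
proof -
  have linE: "linear E" using f by (rule has_derivative_linear)
  obtain L where L: "linear L" "L \<circ> E = id" using linear_injective_left_inverse[OF linE inj] by blast
  obtain K where K: "K > 0" "\<And>x. norm (L x) \<le> norm x * K"
    using bounded_linear.pos_bounded[OF linear_conv_bounded_linear[THEN iffD1, OF L(1)]] by blast
  have LE: "L (E x) = x" for x using L(2) by (metis comp_apply id_apply)
  \<comment> \<open>The Lipschitz constant of \<eta> at t that the absorption below produces; the
    factor 2 compensates for the absorbed half.\<close>
  define M where "M = 2 * K * (norm (E v) + 1)"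
  have M: "M > 0" using K(1) by (simp add: M_def add_nonneg_pos)
  have "\<exists>d>0. \<forall>s\<in>S. norm (s - t) < d \<longrightarrow> norm (\<eta> s - \<eta> t - (s - t) *\<^sub>R v) \<le> e * norm (s - t)" if "e > 0" for e
  proof -
    \<comment> \<open>The first bound lets the error be absorbed into half of
      \<open>norm \<Delta>\<close>. The second, once
      \<open>norm \<Delta> \<le> M * norm (s - t)\<close> is known, gives one half of e; the other
      half comes from \<delta>.\<close>
    define \<epsilon> where "\<epsilon> = min (1 / (2 * K)) (e / (2 * K * M))"
    have \<epsilon>: "\<epsilon> > 0" "\<epsilon> * K \<le> 1/2" "\<epsilon> * M * K \<le> e / 2"
    proof -
      show "\<epsilon> > 0" using K M that by (simp add: \<epsilon>_def)
      have "\<epsilon> \<le> 1 / (2 * K)" "\<epsilon> \<le> e / (2 * K * M)" by (simp_all add: \<epsilon>_def)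
      then show "\<epsilon> * K \<le> 1/2" "\<epsilon> * M * K \<le> e / 2" using K M by (simp_all add: field_simps)
    qed
    obtain d1 where d1: "d1 > 0" "\<And>y. norm (y - \<eta> t) < d1 \<Longrightarrow> norm (f y - f (\<eta> t) - E (y - \<eta> t)) \<le> \<epsilon> * norm (y - \<eta> t)"
      using f \<epsilon>(1) unfolding has_derivative_at_alt by blast
    obtain d2 where d2: "d2 > 0" "\<And>s. s \<in> S \<Longrightarrow> norm (s - t) < d2 \<Longrightarrow> norm (\<eta> s - \<eta> t) < d1"
      using cont d1(1) unfolding continuous_within_eps_delta dist_norm by blast
    define \<delta> where "\<delta> = min 1 (e / (2 * K))"
    have \<delta>: "\<delta> > 0" "\<delta> \<le> 1" "\<delta> * K \<le> e / 2"
    proof -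
      show "\<delta> > 0" "\<delta> \<le> 1" using K that by (simp_all add: \<delta>_def)
      have "\<delta> \<le> e / (2 * K)" by (simp add: \<delta>_def)
      then show "\<delta> * K \<le> e / 2" using K by (simp add: field_simps)
    qed
    obtain d3 where d3: "d3 > 0" "\<And>s. s \<in> S \<Longrightarrow> norm (s - t) < d3 \<Longrightarrow>
        norm (f (\<eta> s) - f (\<eta> t) - (s - t) *\<^sub>R E v) \<le> \<delta> * norm (s - t)"
      using deriv \<delta>(1) unfolding has_vector_derivative_def has_derivative_within_alt by blast
    show ?thesis
    proof (intro exI conjI ballI impI)
      show "min d2 d3 > 0" using d2 d3 by simp
      fix s assume s: "s \<in> S" "norm (s - t) < min d2 d3"
      define \<Delta> F where "\<Delta> = \<eta> s - \<eta> t" and "F = f (\<eta> s) - f (\<eta> t)"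
      have 1: "norm (F - E \<Delta>) \<le> \<epsilon> * norm \<Delta>" using d1(2)[OF d2(2)] s by (simp add: F_def \<Delta>_def)
      have 2: "norm (F - (s - t) *\<^sub>R E v) \<le> \<delta> * norm (s - t)" using d3(2) s by (simp add: F_def)
      have "norm F \<le> norm (F - (s - t) *\<^sub>R E v) + norm ((s - t) *\<^sub>R E v)" by (metis norm_triangle_sub add.commute)
      also have "\<dots> \<le> 1 * norm (s - t) + norm (s - t) * norm (E v)"
        using 2 \<delta>(2) mult_right_mono[of \<delta> 1 "norm (s - t)"] by simp
      finally have F: "norm F \<le> norm (s - t) * (norm (E v) + 1)" by (simp add: algebra_simps)
      have \<Delta>: "\<Delta> = L F - L (F - E \<Delta>)" by (simp add: linear_diff[OF L(1)] LE)
      have "norm \<Delta> \<le> norm (L F) + norm (L (F - E \<Delta>))" by (subst \<Delta>) (rule norm_triangle_ineq4)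
      also have "\<dots> \<le> norm F * K + \<epsilon> * norm \<Delta> * K"
        using K(2)[of F] K(2)[of "F - E \<Delta>"] mult_right_mono[OF 1, of K] K(1) by linarith
      also have "\<dots> \<le> norm F * K + norm \<Delta> / 2"
        using mult_right_mono[OF \<epsilon>(2), of "norm \<Delta>"] by (simp add: mult_ac)
      finally have "norm \<Delta> \<le> 2 * (norm F * K)" by simp
      also have "\<dots> \<le> 2 * ((norm (s - t) * (norm (E v) + 1)) * K)" using F K(1) by simp
      finally have \<Delta>M: "norm \<Delta> \<le> M * norm (s - t)" by (simp add: M_def algebra_simps)
      have "\<Delta> - (s - t) *\<^sub>R v = L (F - (s - t) *\<^sub>R E v) - L (F - E \<Delta>)"
        by (simp add: linear_diff[OF L(1)] linear_cmul[OF L(1)] LE)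
      then have "norm (\<Delta> - (s - t) *\<^sub>R v) \<le> norm (L (F - (s - t) *\<^sub>R E v)) + norm (L (F - E \<Delta>))"
        by (metis norm_triangle_ineq4)
      also have "\<dots> \<le> \<delta> * norm (s - t) * K + \<epsilon> * norm \<Delta> * K"
        using K(2)[of "F - (s - t) *\<^sub>R E v"] K(2)[of "F - E \<Delta>"] mult_right_mono[OF 1, of K] mult_right_mono[OF 2, of K] K(1)
        by linarith
      also have "\<epsilon> * norm \<Delta> * K \<le> \<epsilon> * (M * norm (s - t)) * K"
        using \<Delta>M \<epsilon>(1) K(1) by simp
      also have "\<delta> * norm (s - t) * K + \<epsilon> * (M * norm (s - t)) * K = (\<delta> * K + \<epsilon> * M * K) * norm (s - t)"
        by (simp add: algebra_simps)
      also have "\<dots> \<le> e * norm (s - t)" using \<epsilon>(3) \<delta>(3) by (intro mult_right_mono) auto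
      finally show "norm (\<eta> s - \<eta> t - (s - t) *\<^sub>R v) \<le> e * norm (s - t)" by (simp add: \<Delta>_def)
    qed
  qed
  then show ?thesis
    unfolding has_vector_derivative_def has_derivative_within_alt
    by (simp add: bounded_linear_scaleR_left)
qed

lemma exponential_coordinates_kinematics:
  fixes h :: "real \<Rightarrow> real^(3 + 1)^(3 + 1)"
  assumes "t \<in> S" and SE3: "\<And>s. s \<in> S \<Longrightarrow> h s \<in> SE3"
    and angle: "\<And>s. s \<in> S \<Longrightarrow> principal_angle (rotm (h s)) < pi"
    and \<eta>: "\<And>s. s \<in> S \<Longrightarrow> \<eta> s = pose_log (h s)"
  shows "(h has_vector_derivative h t ** vee \<zeta>) (at t within S) \<longleftrightarrow>
    (\<eta> has_vector_derivative Gmat (\<eta> t) *v \<zeta>) (at t within S)"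
proof -
  have h: "pose_exp (\<eta> s) = h s" and n: "norm (rotv (\<eta> s)) < pi" if "s \<in> S" for s
    using pose_exp_pose_log[OF SE3 angle] that by (simp_all add: \<eta>)
  obtain E where E: "(pose_exp has_derivative E) (at (\<eta> t))"
    and EG: "\<And>\<zeta>. E (Gmat (\<eta> t) *v \<zeta>) = h t ** vee \<zeta>"
    using pose_exp_has_derivative[OF n[OF \<open>t \<in> S\<close>]] h[OF \<open>t \<in> S\<close>] by metis
  have eq: "(h has_vector_derivative d) (at t within S) \<longleftrightarrow>
      ((\<lambda>s. pose_exp (\<eta> s)) has_vector_derivative d) (at t within S)" for d
    by (rule iffI; rule has_vector_derivative_transform[OF \<open>t \<in> S\<close>]; (assumption | simp add: h))
  have linE: "linear E" using E by (rule has_derivative_linear)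
  show ?thesis
  proof
    assume "(\<eta> has_vector_derivative Gmat (\<eta> t) *v \<zeta>) (at t within S)"
    then have "((\<lambda>s. pose_exp (\<eta> s)) has_vector_derivative E (Gmat (\<eta> t) *v \<zeta>)) (at t within S)"
      unfolding has_vector_derivative_def
      using has_derivative_compose[where g = pose_exp and f = \<eta>, OF _ E, of "\<lambda>x. x *\<^sub>R (Gmat (\<eta> t) *v \<zeta>)"] by (simp add: linear_cmul[OF linE])
    then show "(h has_vector_derivative h t ** vee \<zeta>) (at t within S)" by (simp add: eq EG)
  next
    assume dh: "(h has_vector_derivative h t ** vee \<zeta>) (at t within S)"
    have "inj E"
      unfolding linear_injective_0[OF linE]
    proof (intro allI impI)
      fix v assume v: "E v = 0"
      obtain w where w: "Gmat (\<eta> t) *v w = v" using Gmat_surj[OF n[OF \<open>t \<in> S\<close>]] by blast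
      have "h t ** vee w = 0" using EG v w by metis
      then have "matrix_inv (h t) ** (h t ** vee w) = matrix_inv (h t) ** 0" by simp
      then have "vee w = 0"
        using SE3_inverse(4)[OF SE3[OF \<open>t \<in> S\<close>]] by (simp add: matrix_mul_assoc)
      then have "w = 0" using vee_eq_iff[of w 0] by (simp add: vee_simps)
      then show "v = 0" using w by simp
    qed
    moreover have "continuous (at t within S) \<eta>"
    proof -
      have "continuous (at t within S) (\<lambda>s. pose_log (h s))"
        using has_vector_derivative_continuous[OF dh] \<open>t \<in> S\<close> SE3 angle by (intro continuous_pose_log) auto
      then show ?thesis
        by (rule continuous_transform_within[OF _ zero_less_one \<open>t \<in> S\<close>]) (simp add: \<eta>)
    qed
    ultimately show "(\<eta> has_vector_derivative Gmat (\<eta> t) *v \<zeta>) (at t within S)"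
      using dh by (intro has_vector_derivative_inverse[where f = pose_exp and \<eta> = \<eta> and t = t, OF E]) (simp_all add: eq EG)
  qed
qed

section \<open>Kinematics of the relative pose\<close>

lemma at_within_atLeast_neq_bot: "0 \<le> t \<Longrightarrow> at t within {0..} \<noteq> bot" for t :: real
proof -
  assume "0 \<le> t"
  then have "at_right t \<le> at t within {0..}" by (intro at_le) auto
  then show ?thesis using trivial_limit_at_right_real[of t] by (metis bot.extremum_uniqueI)
qed

text \<open>The explicit inverse shows that a derivative exists; its value follows by
  differentiating \<open>P s ** matrix_inv (P s) = mat 1\<close>, where
  \<open>at t within S \<noteq> bot\<close> makes derivatives unique.\<close>

lemma SE3_inverse_has_vector_derivative:
  fixes P :: "real \<Rightarrow> real^(3 + 1)^(3 + 1)"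
  assumes P: "(P has_vector_derivative P') (at t within S)" and "t \<in> S" and nb: "at t within S \<noteq> bot"
    and SE3: "\<And>s. s \<in> S \<Longrightarrow> P s \<in> SE3"
  shows "((\<lambda>s. matrix_inv (P s)) has_vector_derivative - (matrix_inv (P t) ** P' ** matrix_inv (P t))) (at t within S)"
proof -
  define L where "L z = (blockmat (fst z) (columnvector (snd z)) 0 0 :: real^(3 + 1)^(3 + 1))" for z :: "(real^3^3) \<times> (real^3)"
  have L: "bounded_linear L"
    by (auto intro!: linear_conv_bounded_linear[THEN iffD1] linearI
        simp: L_def blockmat_add blockmat_scaleR columnvector_simps)
  have bt: "bounded_linear (transpose :: real^3^3 \<Rightarrow> _)"
    by (auto intro!: linear_conv_bounded_linear[THEN iffD1] linearI simp: transpose_add transpose_scalar)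
  have "((\<lambda>s. rotm (P s)) has_vector_derivative rotm P') (at t within S)"
    by (rule bounded_linear.has_vector_derivative[OF bounded_linear_rotm P])
  note RT = bounded_linear.has_vector_derivative[OF bt this]
  have b: "((\<lambda>s. posv (P s)) has_vector_derivative posv P') (at t within S)"
    by (rule bounded_linear.has_vector_derivative[OF bounded_linear_posv P])
  note Rb = has_vector_derivative_minus[OF bounded_bilinear.has_vector_derivative[OF bounded_bilinear_matrix_vector_mult RT b]]
  note LL = has_vector_derivative_add[OF bounded_linear.has_vector_derivative[OF L has_vector_derivative_Pair[OF RT Rb]]
     has_vector_derivative_const[of "blockmat 0 0 0 (mat 1)"]]
  have eq: "matrix_inv (P s) = L (transpose (rotm (P s)), - (transpose (rotm (P s)) *v posv (P s))) + blockmat 0 0 0 (mat 1)"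
    if "s \<in> S" for s
    unfolding SE3_inverse(1)[OF SE3[OF that]] by (simp add: pose_def L_def blockmat_add)
  obtain Q' where Q: "((\<lambda>s. matrix_inv (P s)) has_vector_derivative Q') (at t within S)"
    using has_vector_derivative_transform[OF \<open>t \<in> S\<close> eq LL] by blast
  have "((\<lambda>s. P s ** matrix_inv (P s)) has_vector_derivative P t ** Q' + P' ** matrix_inv (P t)) (at t within S)"
    by (rule bounded_bilinear.has_vector_derivative[OF bounded_bilinear_matrix_matrix_mult P Q])
  then have "((\<lambda>s. mat 1) has_vector_derivative P t ** Q' + P' ** matrix_inv (P t)) (at t within S)"
    using SE3_inverse(3)[OF SE3] by (intro has_vector_derivative_transform[OF \<open>t \<in> S\<close>, of "\<lambda>s. mat 1"]) auto
  then have "P t ** Q' + P' ** matrix_inv (P t) = 0"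
    using vector_derivative_unique_within[OF nb _ has_vector_derivative_const] by blast
  then have "matrix_inv (P t) ** (P t ** Q' + P' ** matrix_inv (P t)) = matrix_inv (P t) ** 0" by simp
  then have "Q' + matrix_inv (P t) ** P' ** matrix_inv (P t) = 0"
    using SE3_inverse(4)[OF SE3[OF \<open>t \<in> S\<close>]] by (simp add: matrix_add_ldistrib matrix_mul_assoc)
  then have "Q' = - (matrix_inv (P t) ** P' ** matrix_inv (P t))" by (simp only: eq_neg_iff_add_eq_0)
  then show ?thesis using Q by simp
qed

lemma matrix_mult_diff_distrib:
  "A ** (B - C) = A ** B - A ** C" "(D - E) ** C = D ** C - E ** C" "A ** (- B) = - (A ** B)" "(- D) ** C = - (D ** C)"
  for A :: "real^'n^'m" and B C :: "real^'p^'n" and D E :: "real^'n^'m"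
  by (simp_all add: matrix_matrix_mult_def vec_eq_iff right_diff_distrib left_diff_distrib sum_subtractf sum_negf)

text \<open>The product rule gives \<open>h ** vee \<xi> - vee \<xi>hat ** h\<close> as derivative
  of h. Moving h to the left in the second term conjugates \<open>vee \<xi>hat\<close> by the
  inverse of h, which is the origin of \<open>Ad\<close>. Conversely, ghat is recovered as g times
  the inverse of h.\<close>

lemma relative_pose_kinematics:
  fixes g ghat h :: "real \<Rightarrow> real^(3 + 1)^(3 + 1)"
  assumes t: "t \<in> S" and nb: "at t within S \<noteq> bot"
    and g: "\<And>s. s \<in> S \<Longrightarrow> g s \<in> SE3" and ghat: "\<And>s. s \<in> S \<Longrightarrow> ghat s \<in> SE3"
    and h: "\<And>s. s \<in> S \<Longrightarrow> h s = matrix_inv (ghat s) ** g s"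
    and dg: "(g has_vector_derivative g t ** vee \<xi>) (at t within S)"
    and \<xi>e: "\<xi>e = \<xi> - Ad (matrix_inv (h t)) *v \<xi>hat"
  shows "(ghat has_vector_derivative ghat t ** vee \<xi>hat) (at t within S) \<longleftrightarrow>
    (h has_vector_derivative h t ** vee \<xi>e) (at t within S)"
proof -
  note inv = SE3_inverse(2-4)
  have hS: "h s \<in> SE3" if "s \<in> S" for s using that g ghat h by (simp add: SE3_mult inv)
  have gh: "ghat s = g s ** matrix_inv (h s)" if "s \<in> S" for s
  proof -
    have "ghat s ** h s = g s" using that inv(2)[OF ghat[OF that]] by (simp add: h matrix_mul_assoc)
    then have "g s ** matrix_inv (h s) = ghat s ** (h s ** matrix_inv (h s))" by (simp add: matrix_mul_assoc)
    then show ?thesis using inv(2)[OF hS[OF that]] by simp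
  qed
  have ii: "matrix_inv (matrix_inv (h t)) = h t"
    using inv(2,3)[OF hS[OF t]] by (intro matrix_inv_eqI)
  have ad: "vee (Ad (matrix_inv (h t)) *v \<xi>hat) = matrix_inv (h t) ** vee \<xi>hat ** h t"
    using SE3_vee_mult_inverse[OF inv(1)[OF hS[OF t]]] ii by simp
  have h1: "h t ** matrix_inv (h t) = mat 1" "ghat t ** matrix_inv (ghat t) = mat 1" "matrix_inv (ghat t) ** ghat t = mat 1"
    "matrix_inv (h t) ** h t = mat 1"
    using inv hS ghat t by blast+
  have hx: "h t ** vee \<xi>e = h t ** vee \<xi> - vee \<xi>hat ** h t"
  proof -
    have "h t ** (matrix_inv (h t) ** vee \<xi>hat ** h t) = (h t ** matrix_inv (h t)) ** vee \<xi>hat ** h t"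
      by (simp only: matrix_mul_assoc)
    then show ?thesis by (simp add: \<xi>e vee_simps ad matrix_mult_diff_distrib h1)
  qed
  show ?thesis
  proof
    assume *: "(ghat has_vector_derivative ghat t ** vee \<xi>hat) (at t within S)"
    have 1: "((\<lambda>s. matrix_inv (ghat s) ** g s) has_vector_derivative
       matrix_inv (ghat t) ** (g t ** vee \<xi>) + - (matrix_inv (ghat t) ** (ghat t ** vee \<xi>hat) ** matrix_inv (ghat t)) ** g t) (at t within S)"
      by (rule bounded_bilinear.has_vector_derivative[OF bounded_bilinear_matrix_matrix_mult
           SE3_inverse_has_vector_derivative[OF * t nb ghat] dg])
    have 2: "matrix_inv (ghat t) ** (g t ** vee \<xi>) + - (matrix_inv (ghat t) ** (ghat t ** vee \<xi>hat) ** matrix_inv (ghat t)) ** g t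
        = h t ** vee \<xi>e"
    proof -
      have "matrix_inv (ghat t) ** (ghat t ** vee \<xi>hat) ** matrix_inv (ghat t) ** g t
         = (matrix_inv (ghat t) ** ghat t) ** vee \<xi>hat ** (matrix_inv (ghat t) ** g t)" by (simp only: matrix_mul_assoc)
      moreover have "matrix_inv (ghat t) ** (g t ** vee \<xi>) = h t ** vee \<xi>" by (simp add: h t matrix_mul_assoc)
      ultimately show ?thesis by (simp add: hx h1 matrix_mult_diff_distrib h[OF t, symmetric])
    qed
    show "(h has_vector_derivative h t ** vee \<xi>e) (at t within S)"
      by (rule has_vector_derivative_transform[OF t h 1[unfolded 2]])
  next
    assume *: "(h has_vector_derivative h t ** vee \<xi>e) (at t within S)"
    have 1: "((\<lambda>s. g s ** matrix_inv (h s)) has_vector_derivative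
       g t ** - (matrix_inv (h t) ** (h t ** vee \<xi>e) ** matrix_inv (h t)) + (g t ** vee \<xi>) ** matrix_inv (h t)) (at t within S)"
      by (rule bounded_bilinear.has_vector_derivative[OF bounded_bilinear_matrix_matrix_mult
           dg SE3_inverse_has_vector_derivative[OF * t nb hS]])
    have 2: "g t ** - (matrix_inv (h t) ** (h t ** vee \<xi>e) ** matrix_inv (h t)) + (g t ** vee \<xi>) ** matrix_inv (h t)
        = ghat t ** vee \<xi>hat"
    proof -
      have "matrix_inv (h t) ** (h t ** vee \<xi>e) ** matrix_inv (h t) = vee \<xi>e ** matrix_inv (h t)"
        by (simp add: matrix_mul_assoc h1)
      moreover have "vee \<xi>e = vee \<xi> - matrix_inv (h t) ** vee \<xi>hat ** h t" by (simp add: \<xi>e vee_simps ad)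
      moreover have "matrix_inv (h t) ** vee \<xi>hat ** h t ** matrix_inv (h t) = matrix_inv (h t) ** vee \<xi>hat ** (h t ** matrix_inv (h t))"
        by (simp only: matrix_mul_assoc)
      ultimately show ?thesis
        by (simp add: matrix_mult_diff_distrib matrix_mul_assoc h1 gh[OF t])
    qed
    show "(ghat has_vector_derivative ghat t ** vee \<xi>hat) (at t within S)"
      by (rule has_vector_derivative_transform[OF t gh 1[unfolded 2]])
  qed
qed

subsection \<open>Finite-time convergence\<close>

lemma finite_isolated_in_compact:
  fixes Z :: "real set"
  assumes "\<And>t. t \<in> {a..b} \<Longrightarrow> eventually (\<lambda>s. s \<notin> Z) (at t within {a..b})"
  shows "finite (Z \<inter> {a..b})"
proof (rule ccontr)
  assume "infinite (Z \<inter> {a..b})"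
  then obtain l where l: "l \<in> {a..b}" "l islimpt (Z \<inter> {a..b})"
    using compact_Icc[of a b] unfolding compact_eq_Bolzano_Weierstrass by (meson inf_le2)
  obtain d where d: "d > 0" "\<And>s. s \<in> {a..b} \<Longrightarrow> s \<noteq> l \<Longrightarrow> dist s l < d \<Longrightarrow> s \<notin> Z"
    using assms[OF l(1)] unfolding eventually_at by blast
  show False using l(2) d unfolding islimpt_approachable by blast
qed

text \<open>\<open>V powr (1 - q)\<close> falls at rate at least c (1 - q), as for the separable
  equation \<open>v' = - c * v powr q\<close>. The fundamental theorem of calculus is used in the
  form that tolerates a finite exceptional set for a continuous primitive.\<close>

lemma finite_time_decay:
  fixes V :: "real \<Rightarrow> real"
  assumes "a \<le> b" and c: "0 < c" and q: "0 < q" "q < 1"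
    and cont: "continuous_on {a..b} V" and pos: "\<And>t. t \<in> {a..b} \<Longrightarrow> 0 < V t"
    and Z: "finite Z"
    and deriv: "\<And>t. t \<in> {a<..<b} - Z \<Longrightarrow> \<exists>D. (V has_real_derivative D) (at t) \<and> D \<le> - c * V t powr q"
  shows "V b powr (1 - q) \<le> V a powr (1 - q) - c * (1 - q) * (b - a)"
proof -
  define F where "F t = V t powr (1 - q) + c * (1 - q) * t" for t
  obtain D where D: "\<And>t. t \<in> {a<..<b} - Z \<Longrightarrow> (V has_real_derivative D t) (at t) \<and> D t \<le> - c * V t powr q"
    using deriv by metis
  \<comment> \<open>The value 0 at the endpoints and on Z keeps the integrand nonpositive
    everywhere.\<close>
  define F' where "F' t = (if t \<in> {a<..<b} - Z then (1 - q) * V t powr (- q) * D t + c * (1 - q) else 0)" for t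
  have "(F' has_integral F b - F a) {a..b}"
  proof (rule fundamental_theorem_of_calculus_interior_strong[OF Z \<open>a \<le> b\<close>])
    show "continuous_on {a..b} F"
      unfolding F_def using pos cont by (intro continuous_intros) (auto simp: less_imp_neq[symmetric])
    fix t assume t: "t \<in> {a<..<b} - Z"
    then have "V t > 0" using pos by auto
    from DERIV_chain2[OF has_real_derivative_powr[OF this] conjunct1[OF D[OF t]], of "1 - q"]
    have "((\<lambda>x. V x powr (1 - q)) has_real_derivative (1 - q) * V t powr (- q) * D t) (at t)" by simp
    from DERIV_add[OF this DERIV_cmult[OF DERIV_ident, of "c * (1 - q)"]]
    have "(F has_real_derivative F' t) (at t)" unfolding F_def[abs_def] F'_def using t by simp
    then show "(F has_vector_derivative F' t) (at t)" by (simp add: has_real_derivative_iff_has_vector_derivative)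
  qed
  moreover have "F' t \<le> 0" for t
  proof (cases "t \<in> {a<..<b} - Z")
    case True
    then have V: "V t > 0" using pos by auto
    have "V t powr (- q) * D t \<le> V t powr (- q) * (- c * V t powr q)"
      using D[OF True] by (intro mult_left_mono) auto
    also have "\<dots> = - c" using V by (simp add: powr_minus field_simps)
    finally have "(1 - q) * (V t powr (- q) * D t) \<le> (1 - q) * (- c)" using q by (intro mult_left_mono) auto
    then show ?thesis using True by (simp add: F'_def algebra_simps)
  qed (auto simp: F'_def)
  ultimately have "F b - F a \<le> 0"
    using has_integral_le[OF _ has_integral_0, of F' "F b - F a" "{a..b}"] by auto
  then show ?thesis by (simp add: F_def algebra_simps)
qed

text \<open>Z may accumulate where V vanishes, so the decay estimate is applied only on intervals on
  which V is positive; there Z is finite by compactness.\<close>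

lemma finite_time_convergence:
  fixes V :: "real \<Rightarrow> real"
  assumes c: "0 < c" and q: "0 < q" "q < 1"
    and cont: "continuous_on {0..} V" and nonneg: "\<And>t. 0 \<le> t \<Longrightarrow> 0 \<le> V t"
    and isolated: "\<And>t. 0 \<le> t \<Longrightarrow> 0 < V t \<Longrightarrow> eventually (\<lambda>s. s \<notin> Z) (at t within {0..})"
    and deriv: "\<And>t. 0 \<le> t \<Longrightarrow> t \<notin> Z \<Longrightarrow> 0 < V t \<Longrightarrow>
      \<exists>D. (V has_real_derivative D) (at t within {0..}) \<and> D \<le> - c * V t powr q"
  obtains T where "0 \<le> T" "\<And>t. T \<le> t \<Longrightarrow> V t = 0"
proof -
  have decay: "V b powr (1 - q) \<le> V a powr (1 - q) - c * (1 - q) * (b - a)"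
    if "0 \<le> a" "a \<le> b" and pos: "\<And>t. t \<in> {a..b} \<Longrightarrow> 0 < V t" for a b
  proof (rule finite_time_decay[OF \<open>a \<le> b\<close> c q _ pos])
    show "continuous_on {a..b} V" using \<open>0 \<le> a\<close> by (intro continuous_on_subset[OF cont]) auto
    show "finite (Z \<inter> {a..b})"
    proof (rule finite_isolated_in_compact)
      fix t assume "t \<in> {a..b}"
      then have "eventually (\<lambda>s. s \<notin> Z) (at t within {0..})" using isolated pos \<open>0 \<le> a\<close> by simp
      then show "eventually (\<lambda>s. s \<notin> Z) (at t within {a..b})"
        by (rule filter_leD[OF at_le, rotated]) (use \<open>0 \<le> a\<close> in auto)
    qed
    fix t assume t: "t \<in> {a<..<b} - Z \<inter> {a..b}"
    then have "t \<notin> Z" "0 < V t" "0 < t" using pos \<open>0 \<le> a\<close> by auto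
    moreover have "at t within {0..} = at t"
      by (rule at_within_interior) (use \<open>0 < t\<close> in simp)
    ultimately show "\<exists>D. (V has_real_derivative D) (at t) \<and> D \<le> - c * V t powr q"
      using deriv[of t] by simp
  qed
  \<comment> \<open>If V t were positive, let r be the last zero before t. Decay on
    \<open>{x..t}\<close> bounds V t by V x for every x between r and t, and letting x tend to r
    forces V t = 0.\<close>
  have zero: "V t = 0" if "0 \<le> s" "s \<le> t" "V s = 0" for s t
  proof (rule ccontr)
    assume "V t \<noteq> 0"
    define A where "A = {x \<in> {s..t}. V x = 0}"
    have cst: "continuous_on {s..t} V" using \<open>0 \<le> s\<close> by (intro continuous_on_subset[OF cont]) auto
    have "closed A" unfolding A_def by (rule continuous_closed_preimage_constant[OF cst]) simp
    moreover have "A \<noteq> {}" "bdd_above A" using that by (auto simp: A_def)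
    ultimately have SA: "Sup A \<in> A" by (simp add: closed_contains_Sup)
    define r where "r = Sup A"
    have r: "V r = 0" "s \<le> r" "r \<le> t" using SA by (auto simp: A_def r_def)
    have pos: "0 < V x" if "r < x" "x \<le> t" for x
    proof -
      have "x \<notin> A" using that cSup_upper[OF _ \<open>bdd_above A\<close>] by (force simp: r_def)
      then show ?thesis using that r \<open>0 \<le> s\<close> nonneg[of x] by (auto simp: A_def)
    qed
    have "r < t" using r \<open>V t \<noteq> 0\<close> by (cases "r = t") auto
    have r0: "0 \<le> r" using r \<open>0 \<le> s\<close> by linarith
    then have "(V \<longlongrightarrow> 0) (at r within {0..})"
      using cont \<open>V r = 0\<close> by (force simp: continuous_on_def)
    then have "(V \<longlongrightarrow> 0) (at_right r)"
      by (rule tendsto_within_subset) (use r0 in auto)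
    then have lim: "((\<lambda>x. V x powr (1 - q)) \<longlongrightarrow> 0) (at_right r)"
    proof (rule tendsto_zero_powrI[OF _ tendsto_const])
      show "eventually (\<lambda>x. 0 \<le> V x) (at_right r)"
        unfolding eventually_at_filter using nonneg r0 by (auto intro: always_eventually)
    qed (use q in auto)
    have "eventually (\<lambda>x. V t powr (1 - q) \<le> V x powr (1 - q)) (at_right r)"
      unfolding eventually_at_right_field
    proof (intro exI[of _ t] conjI allI impI \<open>r < t\<close>)
      fix x assume "r < x" "x < t"
      moreover have "0 \<le> c * (1 - q) * (t - x)" using c q \<open>x < t\<close> by simp
      ultimately show "V t powr (1 - q) \<le> V x powr (1 - q)"
        using decay[of x t] pos r \<open>0 \<le> s\<close> by fastforce
    qed
    then have "V t powr (1 - q) \<le> 0"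
      by (rule tendsto_lowerbound[OF lim]) (rule trivial_limit_at_right_real)
    then show False using \<open>V t \<noteq> 0\<close> by simp
  qed
  \<comment> \<open>The quotient is the time at which the decay bound reaches zero; the extra 1
    makes the bound strictly negative.\<close>
  define T where "T = V 0 powr (1 - q) / (c * (1 - q)) + 1"
  have cq: "0 < c * (1 - q)" using c q by simp
  have T: "0 \<le> T" using cq by (simp add: T_def)
  have "V T = 0"
  proof (rule ccontr)
    assume "V T \<noteq> 0"
    then have "0 < V t" if "t \<in> {0..T}" for t
      using zero[of t T] nonneg[of t] that by force
    from decay[OF order_refl T this] have "V T powr (1 - q) \<le> V 0 powr (1 - q) - c * (1 - q) * T" by simp
    also have "\<dots> = - (c * (1 - q))" using c q by (simp add: T_def distrib_left)
    finally show False using cq powr_ge_zero[of "V T" "1 - q"] by linarith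
  qed
  then show thesis using that[OF T] zero[OF T] by blast
qed

subsection \<open>The Lyapunov function\<close>

lemma inertia_mult_vec: "rotv (inertia J m *v x) = J *v rotv x" "transv (inertia J m *v x) = m *\<^sub>R transv x"
  by (simp_all add: inertia_def rotv_blockmat transv_blockmat scaleR_matrix_vector_assoc[symmetric])

lemma transpose_inner: "x \<bullet> (transpose A *v y) = (A *v x) \<bullet> y" for A :: "real^'n^'m"
  by (metis dot_lmul_matrix inner_commute transpose_matrix_vector)

lemma transpose_diff: "transpose (A - B) = transpose A - transpose B"
  for A B :: "'a::ab_group_add^'n^'m"
  by (simp add: transpose_def vec_eq_iff)

lemma ad_mult_vec: "rotv (ad x *v y) = rotv x \<times> rotv y" "transv (ad x *v y) = transv x \<times> rotv y + rotv x \<times> transv y"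
  by (simp_all add: ad_def rotv_blockmat transv_blockmat)

text \<open>As \<open>ad x *v x = 0\<close>, the gyroscopic term does no work on the vector with
  which it is formed. The observer is arranged so that this vector is u.\<close>

lemma inner_ad_star_self: "x \<bullet> (ad_star x *v y) = 0"
proof -
  have "ad x *v x = 0"
    by (rule vec6_eqI) (simp_all add: ad_mult_vec cross_skew[of "transv x"])
  then show ?thesis by (simp add: ad_star_def transpose_inner del: transpose_matrix_vector)
qed

lemma ad_star_diff: "ad_star (x - y) *v z = ad_star x *v z - ad_star y *v z"
proof -
  have "ad (x - y) = ad x - ad y"
    by (simp add: ad_def skew_simps blockmat_diff)
  then show ?thesis by (simp add: ad_star_def transpose_diff matrix_vector_mult_diff_rdistrib del: transpose_matrix_vector)
qed

text \<open>Its degree of homogeneity is 1 - 2 \<alpha>. The feedback has \<alpha> = 1 - 1/p, and p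
  < 2 makes the degree positive, as continuity at 0 requires.\<close>

definition homog :: "real \<Rightarrow> 'a::real_inner \<Rightarrow> 'a" where
  "homog \<alpha> x = (1 / (x \<bullet> x) powr \<alpha>) *\<^sub>R x"

lemma norm_homog: "norm (homog \<alpha> x) = norm x powr (1 - 2 * \<alpha>)"
proof (cases "x = 0")
  case False
  have "(x \<bullet> x) powr \<alpha> = norm x powr (2 * \<alpha>)"
    using False by (simp add: power2_norm_eq_inner[symmetric] powr_powr[symmetric])
  then show ?thesis using False by (simp add: homog_def powr_diff)
qed (simp add: homog_def)

lemma isCont_homog:
  assumes "\<alpha> < 1/2"
  shows "isCont (homog \<alpha>) x"
proof (cases "x = 0")
  case True
  have "((\<lambda>y::'a. norm y powr (1 - 2 * \<alpha>)) \<longlongrightarrow> 0) (at 0)"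
    by (rule tendsto_zero_powrI[OF tendsto_norm_zero tendsto_const]) (use assms in \<open>auto intro: tendsto_ident_at\<close>)
  then have "((\<lambda>y::'a. norm (homog \<alpha> y)) \<longlongrightarrow> 0) (at 0)" by (simp add: norm_homog)
  then show ?thesis using True by (simp add: isCont_def tendsto_norm_zero_iff homog_def[of _ 0])
next
  case False
  then show ?thesis unfolding homog_def[abs_def] by (intro continuous_intros) auto
qed

lemma Hmat_mult_vec:
  "Hmat p \<eta> *v v = (1 / (\<eta> \<bullet> \<eta>) powr (1 - 1/p)) *\<^sub>R (v - (2 * (1 - 1/p) * (\<eta> \<bullet> v) / (\<eta> \<bullet> \<eta>)) *\<^sub>R \<eta>)"
  by (simp only: Hmat_def scaleR_matrix_vector_assoc[symmetric] matrix_vector_mult_diff_rdistrib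
      matrix_vector_mul_lid outer_mult_vec scaleR_scaleR times_divide_eq_right times_divide_eq_left mult_1_left mult_1_right mult.assoc)

text \<open>\<open>Hmat\<close> is the Jacobian of the feedback term, which is why the term with
  \<open>Hmat\<close> in the observer cancels the derivative of the feedback in u'.\<close>

lemma homog_has_vector_derivative:
  assumes \<eta>: "(\<eta> has_vector_derivative v) (at t within S)" and "\<eta> t \<noteq> 0"
  shows "((\<lambda>s. homog (1 - 1/p) (\<eta> s)) has_vector_derivative Hmat p (\<eta> t) *v v) (at t within S)"
proof -
  define \<alpha> n where "\<alpha> = 1 - 1/p" and "n = \<eta> t \<bullet> \<eta> t"
  have n: "n > 0" using assms by (simp add: n_def)
  have "((\<lambda>s. \<eta> s \<bullet> \<eta> s) has_vector_derivative (\<eta> t \<bullet> v + v \<bullet> \<eta> t)) (at t within S)"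
    by (rule bounded_bilinear.has_vector_derivative[OF bounded_bilinear_inner \<eta> \<eta>])
  then have sq: "((\<lambda>s. \<eta> s \<bullet> \<eta> s) has_real_derivative 2 * (\<eta> t \<bullet> v)) (at t within S)"
    by (simp add: has_real_derivative_iff_has_vector_derivative inner_commute)
  from DERIV_chain2[OF has_real_derivative_powr[OF n[unfolded n_def]] this, of "- \<alpha>"]
  have "((\<lambda>s. (\<eta> s \<bullet> \<eta> s) powr (- \<alpha>)) has_real_derivative - \<alpha> * n powr (- \<alpha> - 1) * (2 * (\<eta> t \<bullet> v))) (at t within S)"
    by (simp add: n_def)
  from has_vector_derivative_scaleR[OF this \<eta>]
  have *: "((\<lambda>s. (\<eta> s \<bullet> \<eta> s) powr (- \<alpha>) *\<^sub>R \<eta> s) has_vector_derivative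
      n powr (- \<alpha>) *\<^sub>R v + (- \<alpha> * n powr (- \<alpha> - 1) * (2 * (\<eta> t \<bullet> v))) *\<^sub>R \<eta> t) (at t within S)"
    by (simp add: n_def)
  have eq: "n powr (- \<alpha>) *\<^sub>R v + (- \<alpha> * n powr (- \<alpha> - 1) * (2 * (\<eta> t \<bullet> v))) *\<^sub>R \<eta> t = Hmat p (\<eta> t) *v v"
    unfolding Hmat_mult_vec n_def[symmetric] \<alpha>_def[symmetric] using n
    by (simp add: powr_minus powr_diff scaleR_diff_right divide_inverse mult_ac)
  from *[unfolded eq] show ?thesis
    unfolding homog_def[abs_def] \<alpha>_def[symmetric] powr_minus_divide .
qed

lemma divide_powr_eq: "0 \<le> x \<Longrightarrow> x / x powr (1 - q) = x powr q" for x :: real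
  by (cases "x = 0") (simp_all add: powr_diff)

text \<open>With x = a / 2 and y = \<gamma> b / 2, the entries of the minimum are the factors that
  express the left side through \<open>x powr q\<close> and \<open>y powr q\<close>. The division by
  \<open>2 powr q\<close> pays for bounding x + y by twice the maximum.\<close>

lemma lyapunov_derivative_bound:
  fixes a b :: real
  assumes "0 \<le> a" "0 \<le> b" "0 < k" "0 < \<gamma>" "0 < q"
  shows "k * a powr q + k * \<gamma> * b powr q
    \<ge> min (k * 2 powr q) (k * \<gamma> * (2 / \<gamma>) powr q) / 2 powr q * (a / 2 + \<gamma> * b / 2) powr q"
proof -
  define x y c where "x = a / 2" and "y = \<gamma> * b / 2" and "c = min (k * 2 powr q) (k * \<gamma> * (2 / \<gamma>) powr q)"
  have xy: "0 \<le> x" "0 \<le> y" and c: "0 \<le> c" using assms by (simp_all add: x_def y_def c_def)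
  have "(x + y) powr q \<le> (2 * max x y) powr q" using xy assms by (intro powr_mono2) auto
  also have "\<dots> = 2 powr q * max x y powr q" using xy by (simp add: powr_mult)
  also have "max x y powr q \<le> x powr q + y powr q" by (simp add: max_def)
  finally have "c / 2 powr q * (x + y) powr q \<le> c / 2 powr q * (2 powr q * (x powr q + y powr q))"
    using c by (intro mult_left_mono) simp_all
  also have "\<dots> = c * x powr q + c * y powr q" by (simp add: algebra_simps)
  also have "\<dots> \<le> k * 2 powr q * x powr q + k * \<gamma> * (2 / \<gamma>) powr q * y powr q"
    by (intro add_mono mult_right_mono) (simp_all add: c_def)
  also have "k * 2 powr q * x powr q = k * a powr q"
    using assms by (simp add: x_def powr_mult[symmetric])
  also have "k * \<gamma> * (2 / \<gamma>) powr q * y powr q = k * \<gamma> * b powr q"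
    using assms by (simp add: y_def powr_mult[symmetric])
  finally show ?thesis by (simp add: x_def y_def c_def)
qed

text \<open>The Lyapunov argument, detached from poses: the inertia enters as a symmetric positive
  definite M, and the configuration through \<eta>.\<close>

lemma observer_finite_time:
  fixes \<xi> \<xi>b \<xi>e \<eta> u \<phi> :: "real \<Rightarrow> real^(3 + 3)" and M :: "real^(3 + 3)^(3 + 3)"
  assumes k: "0 < k" and \<gamma>: "0 < \<gamma>" and p: "1 < p" "p < 2"
    and sym: "\<And>x y. x \<bullet> (M *v y) = y \<bullet> (M *v x)" and posdef: "\<And>x. x \<noteq> 0 \<Longrightarrow> 0 < x \<bullet> (M *v x)"
    and dyn: "\<And>t. 0 \<le> t \<Longrightarrow> \<exists>\<xi>'. (\<xi> has_vector_derivative \<xi>') (at t within {0..}) \<and>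
           M *v \<xi>' = ad_star (\<xi> t) *v (M *v \<xi> t) + \<phi> t"
    and n: "\<And>t. 0 \<le> t \<Longrightarrow> norm (rotv (\<eta> t)) < pi"
    and d\<eta>: "\<And>t. 0 \<le> t \<Longrightarrow> (\<eta> has_vector_derivative Gmat (\<eta> t) *v \<xi>e t) (at t within {0..})"
    and \<xi>e: "\<And>t. 0 \<le> t \<Longrightarrow> \<xi>e t = \<xi> t - \<xi>b t"
    and u: "\<And>t. 0 \<le> t \<Longrightarrow> u t = \<xi>e t + k *\<^sub>R ((1 / (\<eta> t \<bullet> \<eta> t) powr (1 - 1/p)) *\<^sub>R \<eta> t)"
    and obs: "velocity_observer M k \<gamma> p \<phi> \<xi> \<xi>b \<xi>e \<eta> u"
  shows "\<exists>tf\<ge>0. \<forall>t\<ge>tf. \<xi>e t = 0 \<and> \<eta> t = 0"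
proof -
  define q where "q = 1 / p"
  have q: "1/2 < q" "q < 1" using p by (simp_all add: q_def field_simps)
  \<comment> \<open>Agrees with u from time 0 on and exposes the feedback as \<open>homog\<close>,
    whose continuity and derivative are known.\<close>
  define U where "U t = \<xi> t - \<xi>b t + k *\<^sub>R homog (1 - 1/p) (\<eta> t)" for t
  have U: "u t = U t" if "0 \<le> t" for t using that by (simp add: U_def u \<xi>e homog_def)
  define V where "V t = (U t \<bullet> (M *v U t)) / 2 + \<gamma> * (\<eta> t \<bullet> \<eta> t) / 2" for t
  define Z where "Z = {t. \<eta> t = 0}"
  have psd: "0 \<le> x \<bullet> (M *v x)" for x using posdef[of x] by (cases "x = 0") auto
  have cont_\<eta>: "continuous_on {0..} \<eta>" and cont_\<xi>: "continuous_on {0..} \<xi>"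
    using has_vector_derivative_continuous d\<eta> dyn by (fastforce simp: continuous_on_eq_continuous_within)+
  have cont_\<xi>b: "continuous_on {0..} \<xi>b" using obs by (simp add: velocity_observer_def)
  have "continuous_on UNIV (homog (1 - 1/p) :: real^(3 + 3) \<Rightarrow> _)"
    using q by (intro continuous_at_imp_continuous_on ballI isCont_homog) (simp add: q_def)
  then have "continuous_on {0..} (\<lambda>t. homog (1 - 1/p) (\<eta> t))"
    by (rule continuous_on_compose2[OF _ cont_\<eta>]) simp
  then have cont_U: "continuous_on {0..} U"
    unfolding U_def using cont_\<xi> cont_\<xi>b by (intro continuous_intros)
  have cont_V: "continuous_on {0..} V"
    unfolding V_def using cont_U cont_\<eta>
    by (intro continuous_intros bounded_linear.continuous_on[OF matrix_vector_mul_bounded_linear]) auto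
  have V0: "0 \<le> V t" for t using psd \<gamma> by (simp add: V_def)
  define c where "c = min (k * 2 powr q) (k * \<gamma> * (2 / \<gamma>) powr q) / 2 powr q"
  have c: "0 < c" using k \<gamma> by (simp add: c_def)
  have "\<exists>D. (V has_real_derivative D) (at t within {0..}) \<and> D \<le> - c * V t powr q"
    if t: "0 \<le> t" and "t \<notin> Z" for t
  proof -
    have \<eta>0: "\<eta> t \<noteq> 0" using \<open>t \<notin> Z\<close> by (simp add: Z_def)
    obtain \<xi>' where \<xi>': "(\<xi> has_vector_derivative \<xi>') (at t within {0..})"
      "M *v \<xi>' = ad_star (\<xi> t) *v (M *v \<xi> t) + \<phi> t" using dyn[OF t] by blast
    obtain \<xi>b' where \<xi>b': "(\<xi>b has_vector_derivative \<xi>b') (at t within {0..})"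
      "M *v \<xi>b' = observer_rhs M k \<gamma> p (\<phi> t) (\<xi> t) (\<xi>b t) (\<xi>e t) (\<eta> t) (u t)"
      using obs t \<eta>0 unfolding velocity_observer_def by blast
    define G where "G = Gmat (\<eta> t)"
    define \<eta>' where "\<eta>' = G *v \<xi>e t"
    have d\<eta>': "(\<eta> has_vector_derivative \<eta>') (at t within {0..})" using d\<eta>[OF t] by (simp add: \<eta>'_def G_def)
    define U' where "U' = \<xi>' - \<xi>b' + k *\<^sub>R (Hmat p (\<eta> t) *v \<eta>')"
    have dU: "(U has_vector_derivative U') (at t within {0..})"
      unfolding U_def[abs_def] U'_def
      by (intro has_vector_derivative_add has_vector_derivative_diff \<xi>'(1) \<xi>b'(1)
          bounded_linear.has_vector_derivative[OF bounded_linear_scaleR_right]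
          homog_has_vector_derivative d\<eta>' \<eta>0)
    \<comment> \<open>By linearity of \<open>ad_star\<close>, the gyroscopic terms of the body and
      of the observer thus combine into one formed with U.\<close>
    have UV: "\<xi> t - (\<xi>b t - (k * (\<eta> t \<bullet> \<eta> t) powr (1/p - 1)) *\<^sub>R \<eta> t) = U t"
      using powr_minus[of "\<eta> t \<bullet> \<eta> t" "1 - 1/p"] by (simp add: U_def homog_def divide_inverse)
    have MU: "M *v U' = ad_star (U t) *v (M *v \<xi> t) - \<gamma> *\<^sub>R (transpose G *v \<eta> t)
        - k *\<^sub>R ((1 / (U t \<bullet> (M *v U t)) powr (1 - 1/p)) *\<^sub>R (M *v U t))"
    proof -
      \<comment> \<open>Here f stands for the force \<phi> and h for M times the derivative of the
        feedback; both drop out.\<close>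
      have cancel: "(a + f) - (b + f + h + g + w) + h = a - b - g - w" for a b f g h w :: "real^(3 + 3)"
        by simp
      have "ad_star (U t) *v z = ad_star (\<xi> t) *v z - ad_star (\<xi>b t - (k * (\<eta> t \<bullet> \<eta> t) powr (1/p - 1)) *\<^sub>R \<eta> t) *v z" for z
        by (simp only: UV[symmetric] ad_star_diff)
      then show ?thesis
        by (simp only: U'_def matrix_vector_right_distrib matrix_vector_mult_diff_distrib \<xi>'(2) \<xi>b'(2)
            observer_rhs_def matrix_vector_mult_scaleR G_def[symmetric] \<eta>'_def[symmetric] U[OF t] cancel)
    qed
    \<comment> \<open>Since G fixes \<eta>, the feedback part of \<xi>e contributes the negative
      power. The remaining inner product with G U is cancelled by the first term of
      \<open>UMU\<close>.\<close>
    have G\<eta>: "\<eta> t \<bullet> (G *v \<xi>e t) = \<eta> t \<bullet> (G *v U t) - k * (\<eta> t \<bullet> \<eta> t) powr q"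
    proof -
      have "\<xi>e t = U t - k *\<^sub>R homog (1 - 1/p) (\<eta> t)" by (simp add: U_def \<xi>e[OF t])
      moreover have "G *v \<eta> t = \<eta> t" unfolding G_def by (rule Gmat_fixes[OF n[OF t]])
      ultimately show ?thesis
        using arg_cong[OF divide_powr_eq[of "\<eta> t \<bullet> \<eta> t" q, OF inner_ge_zero], of "(*) k"]
        by (simp add: matrix_vector_mult_diff_distrib matrix_vector_mult_scaleR homog_def inner_diff_right q_def)
    qed
    have UMU: "U t \<bullet> (M *v U') = - \<gamma> * (\<eta> t \<bullet> (G *v U t)) - k * (U t \<bullet> (M *v U t)) powr q"
      unfolding MU using arg_cong[OF divide_powr_eq[OF psd, of "U t" q], of "(*) k"]
      by (simp add: inner_diff_right inner_ad_star_self transpose_inner inner_commute[of "G *v U t"] q_def del: transpose_matrix_vector)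
    have "((\<lambda>s. U s \<bullet> (M *v U s)) has_vector_derivative U t \<bullet> (M *v U') + U' \<bullet> (M *v U t)) (at t within {0..})"
      by (rule bounded_bilinear.has_vector_derivative[OF bounded_bilinear_inner dU
            bounded_linear.has_vector_derivative[OF matrix_vector_mul_bounded_linear dU]])
    then have 1: "((\<lambda>s. U s \<bullet> (M *v U s)) has_real_derivative 2 * (U t \<bullet> (M *v U'))) (at t within {0..})"
      by (simp add: has_real_derivative_iff_has_vector_derivative sym[of U'])
    have "((\<lambda>s. \<eta> s \<bullet> \<eta> s) has_vector_derivative \<eta> t \<bullet> \<eta>' + \<eta>' \<bullet> \<eta> t) (at t within {0..})"
      by (rule bounded_bilinear.has_vector_derivative[OF bounded_bilinear_inner d\<eta>' d\<eta>'])
    then have 2: "((\<lambda>s. \<eta> s \<bullet> \<eta> s) has_real_derivative 2 * (\<eta> t \<bullet> \<eta>')) (at t within {0..})"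
      by (simp add: has_real_derivative_iff_has_vector_derivative inner_commute)
    have "(V has_real_derivative 2 * (U t \<bullet> (M *v U')) / 2 + \<gamma> * (2 * (\<eta> t \<bullet> \<eta>')) / 2) (at t within {0..})"
      unfolding V_def[abs_def] by (intro DERIV_add DERIV_cdivide DERIV_cmult 1 2)
    moreover have "2 * (U t \<bullet> (M *v U')) / 2 + \<gamma> * (2 * (\<eta> t \<bullet> \<eta>')) / 2
        = - (k * (U t \<bullet> (M *v U t)) powr q + k * \<gamma> * (\<eta> t \<bullet> \<eta> t) powr q)"
      unfolding UMU \<eta>'_def G\<eta> by (simp add: field_simps)
    moreover have "\<dots> \<le> - c * V t powr q"
      using lyapunov_derivative_bound[OF psd inner_ge_zero k \<gamma>, of q "U t" "\<eta> t"] q by (simp add: c_def V_def)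
    ultimately show ?thesis by metis
  qed
  moreover have "eventually (\<lambda>s. s \<notin> Z) (at t within {0..})" if t: "0 \<le> t" and V: "0 < V t" for t
  proof (cases "\<eta> t = 0")
    case False
    have "(\<eta> \<longlongrightarrow> \<eta> t) (at t within {0..})" using cont_\<eta> t by (simp add: continuous_on_def)
    from tendsto_imp_eventually_ne[OF this False] show ?thesis by (simp add: Z_def)
  next
    case True
    \<comment> \<open>A zero of \<open>\<eta>\<close> is isolated because there \<open>\<eta>' = \<xi>e = u\<close>, which does not vanish as \<open>V > 0\<close>.\<close>
    have v: "\<xi>e t \<noteq> 0"
    proof
      assume "\<xi>e t = 0"
      then have "U t = 0" using True t by (simp add: U_def \<xi>e homog_def)
      then show False using V True by (simp add: V_def)
    qed
    have "(\<eta> has_vector_derivative \<xi>e t) (at t within {0..})" using d\<eta>[OF t] by (simp add: True Gmat_0)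
    then obtain d where d: "d > 0" "\<And>s. s \<in> {0..} \<Longrightarrow> norm (s - t) < d \<Longrightarrow>
        norm (\<eta> s - \<eta> t - (s - t) *\<^sub>R \<xi>e t) \<le> norm (\<xi>e t) / 2 * norm (s - t)"
      unfolding has_vector_derivative_def has_derivative_within_alt using v by (metis half_gt_zero zero_less_norm_iff)
    have "\<eta> s \<noteq> 0" if s: "s \<in> {0..}" "s \<noteq> t" "dist s t < d" for s
    proof
      assume "\<eta> s = 0"
      then have "\<bar>s - t\<bar> * norm (\<xi>e t) \<le> norm (\<xi>e t) / 2 * \<bar>s - t\<bar>"
        using d(2)[of s] s True by (simp add: dist_norm)
      then show False using v s by (simp add: mult.commute)
    qed
    then show ?thesis using d(1) unfolding eventually_at Z_def by blast
  qed
  ultimately obtain T where T: "0 \<le> T" "\<And>t. T \<le> t \<Longrightarrow> V t = 0"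
    using finite_time_convergence[OF c _ q(2) cont_V V0, of Z] q by (metis half_gt_zero zero_less_one order_less_trans)
  have "\<xi>e t = 0 \<and> \<eta> t = 0" if "T \<le> t" for t
  proof -
    have "0 \<le> t" using T that by simp
    have "U t \<bullet> (M *v U t) = 0" "\<eta> t \<bullet> \<eta> t = 0"
      using T(2)[OF that] psd[of "U t"] \<gamma> inner_ge_zero[of "\<eta> t"] mult_nonneg_nonneg[of \<gamma> "\<eta> t \<bullet> \<eta> t"]
      unfolding V_def by (auto simp: add_nonneg_eq_0_iff)
    then have "U t = 0" "\<eta> t = 0" using posdef[of "U t"] by auto
    then show ?thesis using \<open>0 \<le> t\<close> by (simp add: U_def \<xi>e homog_def)
  qed
  then show ?thesis using T(1) by blast
qed

theorem theorem3p1: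
  fixes k \<gamma> p m :: real
    and J :: "real^3^3"
    and g ghat h :: "real \<Rightarrow> real^(3 + 1)^(3 + 1)"
    and \<phi> \<xi> \<xi>hat \<xi>b \<xi>e \<eta> u :: "real \<Rightarrow> real^(3 + 3)"
  assumes "k > 0" and "\<gamma> > 0"
    and "p \<in> \<rat>" and "1 < p" and "p < 2"
    and "m > 0"
    and "transpose J = J" and "\<forall>x. x \<noteq> 0 \<longrightarrow> x \<bullet> (J *v x) > 0"
    and g_SE3: "\<forall>t\<ge>0. g t \<in> SE3"
    and g_kinematics: "\<forall>t\<ge>0. (g has_vector_derivative g t ** vee (\<xi> t)) (at t within {0..})"
    and g_dynamics: "\<forall>t\<ge>0. \<exists>\<xi>'. (\<xi> has_vector_derivative \<xi>') (at t within {0..}) \<and>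
           inertia J m *v \<xi>' = ad_star (\<xi> t) *v (inertia J m *v \<xi> t) + \<phi> t"
    and ghat_SE3: "\<forall>t\<ge>0. ghat t \<in> SE3"
    and h: "\<forall>t\<ge>0. h t = matrix_inv (ghat t) ** g t"
    and angle: "\<forall>t\<ge>0. principal_angle (rotm (h t)) < pi"
    and \<eta>: "\<forall>t\<ge>0. vee (\<eta> t) = logm (h t)"
    and \<xi>b: "\<forall>t\<ge>0. \<xi>b t = Ad (matrix_inv (h t)) *v \<xi>hat t"
    and \<xi>e: "\<forall>t\<ge>0. \<xi>e t = \<xi> t - \<xi>b t"
    and u: "\<forall>t\<ge>0. u t = \<xi>e t + k *\<^sub>R ((1 / (\<eta> t \<bullet> \<eta> t) powr (1 - 1/p)) *\<^sub>R \<eta> t)"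
  shows "((\<forall>t\<ge>0. (ghat has_vector_derivative ghat t ** vee (\<xi>hat t)) (at t within {0..})) \<longleftrightarrow>
          (\<forall>t\<ge>0. (\<eta> has_vector_derivative Gmat (\<eta> t) *v \<xi>e t) (at t within {0..}) \<and>
                  ghat t = g t ** expm (- vee (\<eta> t))))
       \<and> ((\<forall>t\<ge>0. (ghat has_vector_derivative ghat t ** vee (\<xi>hat t)) (at t within {0..})) \<and>
          velocity_observer (inertia J m) k \<gamma> p \<phi> \<xi> \<xi>b \<xi>e \<eta> u \<longrightarrow>
          (\<exists>tf\<ge>0. \<forall>t\<ge>tf. \<xi>e t = 0 \<and> \<eta> t = 0))"
proof -
  let ?M = "inertia J m"
  have hS: "h t \<in> SE3" if "t \<in> {0..}" for t
    using that h g_SE3 ghat_SE3 by (simp add: SE3_mult SE3_inverse(2))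
  have ang: "principal_angle (rotm (h t)) < pi" if "t \<in> {0..}" for t using that angle by simp
  have log: "\<eta> t = pose_log (h t)" if "t \<in> {0..}" for t
    using \<eta> logm_eq[OF hS ang] that by (simp add: vee_eq_iff)
  note exp = pose_exp_pose_log[OF hS ang]
  \<comment> \<open>A consequence of the definition of \<eta> alone, so this half of the coordinate
    form holds without any kinematics.\<close>
  have pose: "ghat t = g t ** expm (- vee (\<eta> t))" if t: "t \<in> {0..}" for t
  proof -
    have "expm (- vee (\<eta> t)) = matrix_inv (h t)"
      using pose_exp_uminus[of "\<eta> t"] exp[OF t t] hS[OF t] by (simp add: expm_vee vee_simps(5)[symmetric] log[OF t])
    moreover have "ghat t ** h t = g t"
      using h ghat_SE3 t by (simp add: matrix_mul_assoc SE3_inverse(3))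
    then have "ghat t ** (h t ** matrix_inv (h t)) = g t ** matrix_inv (h t)" by (simp add: matrix_mul_assoc)
    ultimately show ?thesis using SE3_inverse(3)[OF hS[OF t]] by simp
  qed
  have kin: "(ghat has_vector_derivative ghat t ** vee (\<xi>hat t)) (at t within {0..}) \<longleftrightarrow>
      (\<eta> has_vector_derivative Gmat (\<eta> t) *v \<xi>e t) (at t within {0..})" if t: "t \<in> {0..}" for t
  proof -
    have "(ghat has_vector_derivative ghat t ** vee (\<xi>hat t)) (at t within {0..}) \<longleftrightarrow>
        (h has_vector_derivative h t ** vee (\<xi>e t)) (at t within {0..})"
      using t g_SE3 ghat_SE3 h g_kinematics \<xi>e \<xi>b at_within_atLeast_neq_bot
      by (intro relative_pose_kinematics) auto
    also have "\<dots> \<longleftrightarrow> (\<eta> has_vector_derivative Gmat (\<eta> t) *v \<xi>e t) (at t within {0..})"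
      by (rule exponential_coordinates_kinematics[OF t hS ang log])
    finally show ?thesis .
  qed
  have sym: "x \<bullet> (?M *v y) = y \<bullet> (?M *v x)" for x y
    using \<open>transpose J = J\<close> transpose_inner[of "rotv x" J "rotv y"]
    by (simp add: inner_vec6 inertia_mult_vec inner_commute del: transpose_matrix_vector)
  have posdef: "0 < x \<bullet> (?M *v x)" if "x \<noteq> 0" for x
  proof -
    have "0 \<le> rotv x \<bullet> (J *v rotv x)" "0 \<le> m * (transv x \<bullet> transv x)"
      using assms(8)[rule_format, of "rotv x"] \<open>m > 0\<close> by (cases "rotv x = 0"; simp)+
    moreover have "rotv x \<noteq> 0 \<or> transv x \<noteq> 0" using that vec6_eqI[of x 0] by auto
    then have "0 < rotv x \<bullet> (J *v rotv x) \<or> 0 < m * (transv x \<bullet> transv x)"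
      using assms(8) \<open>m > 0\<close> by auto
    ultimately show ?thesis by (auto simp: inner_vec6 inertia_mult_vec)
  qed
  have "\<exists>tf\<ge>0. \<forall>t\<ge>tf. \<xi>e t = 0 \<and> \<eta> t = 0"
    if "\<forall>t\<ge>0. (ghat has_vector_derivative ghat t ** vee (\<xi>hat t)) (at t within {0..})"
      and "velocity_observer ?M k \<gamma> p \<phi> \<xi> \<xi>b \<xi>e \<eta> u"
  proof (rule observer_finite_time[OF \<open>k > 0\<close> \<open>\<gamma> > 0\<close> \<open>1 < p\<close> \<open>p < 2\<close> sym posdef])
    show "norm (rotv (\<eta> t)) < pi" if "0 \<le> t" for t using exp(2)[of t] log[of t] that by simp
    show "(\<eta> has_vector_derivative Gmat (\<eta> t) *v \<xi>e t) (at t within {0..})" if "0 \<le> t" for t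
      using kin[of t] that \<open>\<forall>t\<ge>0. (ghat has_vector_derivative _) _\<close> by simp
  qed (use g_dynamics \<xi>e u that in auto)
  then show ?thesis using kin pose by auto
qed

end
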